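(* Let $(\mathcal{U},\|\cdot\|_{\mathcal{U}})$ be a Banach ideal of $3$-linear forms. Then, for every triple of Banach spaces $\mathbf{X}=X_1\times X_2\times X_3$, the set of those $3$-linear forms in $\mathcal{U}(\mathbf{X})$ all of whose Arens extensions attain the supremum norm at the same $3$-tuple is $\|\cdot\|_{\mathcal{U}}$-dense in $\mathcal{U}(\mathbf{X})$.
   Context: Notation: $\mathbb{K}$ is the scalar field ($\mathbb{R}$ or $\mathbb{C}$), $X'$ is the topological dual of $X$, $B_X$ the closed unit ball. For $\mathbf{X}=X_1\times\cdots\times X_N$ (here $N=3$), $\mathcal{L}(^N\mathbf{X})$ is the space of continuous $N$-linear forms $\mathbf{X}\to\mathbb{K}$ with the supremum norm $\|\cdot\|$. Ideal of $N$-linear forms: a normed ideal of $N$-linear forms is a pair $(\mathcal{U},\|\cdot\|_{\mathcal{U}})$ such that for every $N$-tuple of Banach spaces $\mathbf{X}$: (i) $\mathcal{U}(\mathbf{X})=\mathcal{U}\cap\mathcal{L}(^N\mathbf{X})$ is a linear subspace of $\mathcal{L}(^N\mathbf{X})$ and $\|\cdot\|_{\mathcal{U}}$ is a norm on it; (ii) for every $N$-tuple of Banach spaces $\mathbf{Z}=Z_1\times\cdots\times Z_N$, all bounded linear operators $T_i:Z_i\to X_i$ and all $\Phi\in\mathcal{U}(\mathbf{X})$, the form $\Phi\circ(T_1,\dots,T_N)$ belongs to $\mathcal{U}(\mathbf{Z})$ with $\|\Phi\circ(T_1,\dots,T_N)\|_{\mathcal{U}}\le\|\Phi\|_{\mathcal{U}}\|T_1\|\cdots\|T_N\|$;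 (iii) $(z_1,\dots,z_N)\mapsto z_1\cdots z_N$ belongs to $\mathcal{U}(\mathbb{K}^N)$ and has $\mathcal{U}$-norm one. It is a Banach ideal if every $(\mathcal{U}(\mathbf{X}),\|\cdot\|_{\mathcal{U}})$ is complete. Arens extensions: for each permutation $\sigma$ of $\{1,\dots,N\}$, the corresponding Arens extension of $\Phi\in\mathcal{L}(^N\mathbf{X})$ is the $N$-linear form on $X_1''\times\cdots\times X_N''$ given at $(x_1'',\dots,x_N'')$ by the iterated limit $\lim_{\alpha_{\sigma(1)}}\cdots\lim_{\alpha_{\sigma(N)}}\Phi(x_{1,\alpha_1},\dots,x_{N,\alpha_N})$, where $(x_{j,\alpha_j})_{\alpha_j}\subset X_j$ is a bounded net $w^*$-convergent to $x_j''$. There are $N!$ of them, each with norm $\|\Phi\|$. They attain the supremum norm at the same $N$-tuple if there is a single $(a_1'',\dots,a_N'')\in B_{X_1''}\times\cdots\times B_{X_N''}$ at which each of the $N!$ Arens extensions has absolute value $\|\Phi\|$. *)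

theory Defs
  imports "HOL-Analysis.Analysis" "HOL-Algebra.Module"
begin

text \<open>
  Ideals of multilinear forms are families indexed by all Banach spaces, so Banach spaces are
  rendered as records with an explicit carrier instead of as a type class.

  The scalars are a type \<open>'k :: {real_normed_field, euclidean_space}\<close>. Both \<open>real\<close> and
  \<open>complex\<close> are instances, and, the norm being multiplicative, every instance is isometrically
  isomorphic to one of these two.
  The fields \<open>mult\<close> and \<open>one\<close> that \<open>module\<close> inherits from \<open>ring\<close> play no role.
\<close>

definition scalar_ring :: "'k::{real_normed_field, euclidean_space} ring" where
  "scalar_ring = \<lparr>carrier = UNIV, monoid.mult = (*), one = 1, zero = 0, add = (+)\<rparr>"

record ('k, 'u) nspace = "('k, 'u) module" +
  nrm :: "'u \<Rightarrow> real"

locale normed_space =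
  Module.module scalar_ring X
  for X :: "('k::{real_normed_field, euclidean_space}, 'u) nspace" (structure) +
  assumes nrm_nonneg: "x \<in> carrier X \<Longrightarrow> 0 \<le> nrm X x"
    and nrm_eq_0_iff: "x \<in> carrier X \<Longrightarrow> nrm X x = 0 \<longleftrightarrow> x = \<zero>\<^bsub>X\<^esub>"
    and nrm_smult: "x \<in> carrier X \<Longrightarrow> nrm X (a \<odot>\<^bsub>X\<^esub> x) = norm a * nrm X x"
    and nrm_triangle:
      "x \<in> carrier X \<Longrightarrow> y \<in> carrier X \<Longrightarrow> nrm X (x \<oplus>\<^bsub>X\<^esub> y) \<le> nrm X x + nrm X y"

text \<open>\<open>Metric_space\<close> asks for nonnegativity and symmetry outside the carrier as well.\<close>

definition ndist :: "('k, 'u) nspace \<Rightarrow> 'u \<Rightarrow> 'u \<Rightarrow> real" where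
  "ndist X x y = (if x \<in> carrier X \<and> y \<in> carrier X then nrm X (x \<ominus>\<^bsub>X\<^esub> y) else 0)"

definition norm_topology :: "('k, 'u) nspace \<Rightarrow> 'u topology" where
  "norm_topology X = Metric_space.mtopology (carrier X) (ndist X)"

definition unit_ball :: "('k, 'u) nspace \<Rightarrow> 'u set" where
  "unit_ball X = {x \<in> carrier X. nrm X x \<le> 1}"

locale banach_space = normed_space +
  assumes complete: "Metric_space.mcomplete (carrier X) (ndist X)"

definition bounded_operator ::
  "('k::{real_normed_field, euclidean_space}, 'u) nspace \<Rightarrow> ('k, 'v) nspace \<Rightarrow> ('u \<Rightarrow> 'v) \<Rightarrow> bool" where
  "bounded_operator Z X T \<longleftrightarrow>
     T \<in> carrier Z \<rightarrow> carrier X \<and>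
     (\<forall>z\<in>carrier Z. \<forall>w\<in>carrier Z. T (z \<oplus>\<^bsub>Z\<^esub> w) = T z \<oplus>\<^bsub>X\<^esub> T w) \<and>
     (\<forall>a. \<forall>z\<in>carrier Z. T (a \<odot>\<^bsub>Z\<^esub> z) = a \<odot>\<^bsub>X\<^esub> T z) \<and>
     (\<exists>C. \<forall>z\<in>carrier Z. nrm X (T z) \<le> C * nrm Z z)"

definition operator_norm ::
  "('k, 'u) nspace \<Rightarrow> ('k, 'v) nspace \<Rightarrow> ('u \<Rightarrow> 'v) \<Rightarrow> real" where
  "operator_norm Z X T = (SUP z\<in>unit_ball Z. nrm X (T z))"

text \<open>
  Functionals and multilinear forms are total functions that vanish off their domain, so that
  equality and the pointwise operations of \<open>fun_space\<close> are the intended ones.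
\<close>

definition fun_space ::
  "('a \<Rightarrow> 'k::{real_normed_field, euclidean_space}) set \<Rightarrow> (('a \<Rightarrow> 'k) \<Rightarrow> real) \<Rightarrow> ('k, 'a \<Rightarrow> 'k) nspace" where
  "fun_space A n = \<lparr>carrier = A, monoid.mult = undefined, one = undefined,
     zero = (\<lambda>_. 0), add = (\<lambda>f g x. f x + g x), smult = (\<lambda>a f x. a * f x), nrm = n\<rparr>"

definition dual ::
  "('k::{real_normed_field, euclidean_space}, 'u) nspace \<Rightarrow> ('k, 'u \<Rightarrow> 'k) nspace" where
  "dual X = fun_space
     {f. (\<forall>x. x \<notin> carrier X \<longrightarrow> f x = 0) \<and>
         (\<forall>x\<in>carrier X. \<forall>y\<in>carrier X. f (x \<oplus>\<^bsub>X\<^esub> y) = f x + f y) \<and>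
         (\<forall>a. \<forall>x\<in>carrier X. f (a \<odot>\<^bsub>X\<^esub> x) = a * f x) \<and>
         continuous_map (norm_topology X) euclidean f}
     (\<lambda>f. SUP x\<in>unit_ball X. norm (f x))"

definition tuples :: "nat \<Rightarrow> (nat \<Rightarrow> ('k, 'u) nspace) \<Rightarrow> (nat \<Rightarrow> 'u) set" where
  "tuples N X = (\<Pi>\<^sub>E i\<in>{1..N}. carrier (X i))"

definition multilinear_forms ::
  "nat \<Rightarrow> (nat \<Rightarrow> ('k::{real_normed_field, euclidean_space}, 'u) nspace) \<Rightarrow> ((nat \<Rightarrow> 'u) \<Rightarrow> 'k) set" where
  "multilinear_forms N X =
     {\<Phi>. (\<forall>x. x \<notin> tuples N X \<longrightarrow> \<Phi> x = 0) \<and>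
         (\<forall>x\<in>tuples N X. \<forall>i\<in>{1..N}. \<forall>u\<in>carrier (X i). \<forall>v\<in>carrier (X i).
            \<Phi> (x(i := u \<oplus>\<^bsub>X i\<^esub> v)) = \<Phi> (x(i := u)) + \<Phi> (x(i := v))) \<and>
         (\<forall>x\<in>tuples N X. \<forall>i\<in>{1..N}. \<forall>a. \<forall>u\<in>carrier (X i).
            \<Phi> (x(i := a \<odot>\<^bsub>X i\<^esub> u)) = a * \<Phi> (x(i := u))) \<and>
         continuous_map (product_topology (\<lambda>i. norm_topology (X i)) {1..N}) euclidean \<Phi>}"

definition sup_norm ::
  "nat \<Rightarrow> (nat \<Rightarrow> ('k::{real_normed_field, euclidean_space}, 'u) nspace) \<Rightarrow> ((nat \<Rightarrow> 'u) \<Rightarrow> 'k) \<Rightarrow> real" where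
  "sup_norm N X \<Phi> = (SUP x\<in>(\<Pi>\<^sub>E i\<in>{1..N}. unit_ball (X i)). norm (\<Phi> x))"

text \<open>
  Since one cannot quantify over types inside a formula, ``all Banach spaces'' are all Banach
  spaces with carrier in one type \<open>'k + 'u\<close>, where \<open>'u\<close> is an arbitrary type. The left
  summand only serves to make the scalar field itself one of these spaces. An ideal defined on
  all Banach spaces restricts to an ideal in this sense, and any given Banach spaces live in a
  large enough \<open>'u\<close>.
\<close>

definition scalar_space :: "('k::{real_normed_field, euclidean_space}, 'k + 'u) nspace" where
  "scalar_space = \<lparr>carrier = range Inl, monoid.mult = undefined, one = undefined,
     zero = Inl 0, add = (\<lambda>x y. Inl (projl x + projl y)),
     smult = (\<lambda>a x. Inl (a * projl x)), nrm = (\<lambda>x. norm (projl x))\<rparr>"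

definition banach_tuples ::
  "nat \<Rightarrow> (nat \<Rightarrow> ('k::{real_normed_field, euclidean_space}, 'u) nspace) set" where
  "banach_tuples N = {1..N} \<rightarrow>\<^sub>E {X. banach_space X}"

definition compose_form ::
  "nat \<Rightarrow> (nat \<Rightarrow> ('k::{real_normed_field, euclidean_space}, 'u) nspace) \<Rightarrow>
   ((nat \<Rightarrow> 'v) \<Rightarrow> 'k) \<Rightarrow> (nat \<Rightarrow> 'u \<Rightarrow> 'v) \<Rightarrow> (nat \<Rightarrow> 'u) \<Rightarrow> 'k" where
  "compose_form N Z \<Phi> T =
     (\<lambda>z. if z \<in> tuples N Z then \<Phi> (\<lambda>i\<in>{1..N}. T i (z i)) else 0)"

definition scalar_product_form :: "nat \<Rightarrow> (nat \<Rightarrow> 'k::{real_normed_field, euclidean_space} + 'u) \<Rightarrow> 'k" where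
  "scalar_product_form N =
     (\<lambda>z. if z \<in> tuples N (\<lambda>_. scalar_space) then \<Prod>i=1..N. projl (z i) else 0)"

text \<open>\<open>U X\<close> is the component of the ideal on the tuple \<open>X\<close> and \<open>nU X\<close> is its norm.\<close>

locale normed_ideal =
  fixes N :: nat
    and U :: "(nat \<Rightarrow> ('k::{real_normed_field, euclidean_space}, 'k + 'u) nspace) \<Rightarrow>
              ((nat \<Rightarrow> 'k + 'u) \<Rightarrow> 'k) set"
    and nU :: "(nat \<Rightarrow> ('k, 'k + 'u) nspace) \<Rightarrow> ((nat \<Rightarrow> 'k + 'u) \<Rightarrow> 'k) \<Rightarrow> real"
  assumes forms: "X \<in> banach_tuples N \<Longrightarrow> U X \<subseteq> multilinear_forms N X"
    and normed: "X \<in> banach_tuples N \<Longrightarrow> normed_space (fun_space (U X) (nU X))"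
    and compose_mem:
      "\<lbrakk>X \<in> banach_tuples N; Z \<in> banach_tuples N;
        \<And>i. i \<in> {1..N} \<Longrightarrow> bounded_operator (Z i) (X i) (T i); \<Phi> \<in> U X\<rbrakk>
       \<Longrightarrow> compose_form N Z \<Phi> T \<in> U Z"
    and compose_norm:
      "\<lbrakk>X \<in> banach_tuples N; Z \<in> banach_tuples N;
        \<And>i. i \<in> {1..N} \<Longrightarrow> bounded_operator (Z i) (X i) (T i); \<Phi> \<in> U X\<rbrakk>
       \<Longrightarrow> nU Z (compose_form N Z \<Phi> T) \<le> nU X \<Phi> * (\<Prod>i=1..N. operator_norm (Z i) (X i) (T i))"
    and product_mem: "scalar_product_form N \<in> U (\<lambda>i\<in>{1..N}. scalar_space)"
    and product_norm: "nU (\<lambda>i\<in>{1..N}. scalar_space) (scalar_product_form N) = 1"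

locale banach_ideal = normed_ideal +
  assumes banach: "X \<in> banach_tuples N \<Longrightarrow> banach_space (fun_space (U X) (nU X))"

text \<open>
  Nets in \<open>X\<close> are represented by proper filters on the carrier of \<open>X\<close> (the image of the
  tail filter of the index set).
\<close>

definition bounded_net_wstar_to ::
  "('k::{real_normed_field, euclidean_space}, 'u) nspace \<Rightarrow> 'u filter \<Rightarrow> (('u \<Rightarrow> 'k) \<Rightarrow> 'k) \<Rightarrow> bool" where
  "bounded_net_wstar_to X F x'' \<longleftrightarrow>
     F \<noteq> bot \<and>
     (\<exists>C. \<forall>\<^sub>F x in F. x \<in> carrier X \<and> nrm X x \<le> C) \<and>
     (\<forall>f\<in>carrier (dual X). (f \<longlongrightarrow> x'' f) F)"

text \<open>
  \<open>iterated_lim F \<Phi> [j\<^sub>1, \<dots>, j\<^sub>m] x\<close> is the iterated limit of \<open>\<Phi>\<close> with the limit along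
  \<open>F j\<^sub>1\<close> outermost and the one along \<open>F j\<^sub>m\<close> innermost, the remaining coordinates being
  those of \<open>x\<close>.
\<close>

primrec iterated_lim ::
  "(nat \<Rightarrow> 'u filter) \<Rightarrow> ((nat \<Rightarrow> 'u) \<Rightarrow> 'k::t2_space) \<Rightarrow> nat list \<Rightarrow> (nat \<Rightarrow> 'u) \<Rightarrow> 'k" where
  "iterated_lim F \<Phi> [] x = \<Phi> x"
| "iterated_lim F \<Phi> (j # js) x = Lim (F j) (\<lambda>y. iterated_lim F \<Phi> js (x(j := y)))"

text \<open>
  For \<open>\<Phi>\<close> a continuous form and \<open>x''\<close> in the product of the biduals, nets as below exist by
  Goldstine's theorem, and all of them give the same iterated limit.
\<close>

definition arens_extension ::
  "nat \<Rightarrow> (nat \<Rightarrow> ('k::{real_normed_field, euclidean_space}, 'u) nspace) \<Rightarrow> ((nat \<Rightarrow> 'u) \<Rightarrow> 'k) \<Rightarrow>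
   (nat \<Rightarrow> nat) \<Rightarrow> (nat \<Rightarrow> ('u \<Rightarrow> 'k) \<Rightarrow> 'k) \<Rightarrow> 'k" where
  "arens_extension N X \<Phi> \<sigma> x'' =
     (THE L. \<exists>F. (\<forall>i\<in>{1..N}. bounded_net_wstar_to (X i) (F i) (x'' i)) \<and>
        L = iterated_lim F \<Phi> (map \<sigma> [1..<N+1]) (\<lambda>_. undefined))"

definition arens_attain_at_same_tuple ::
  "nat \<Rightarrow> (nat \<Rightarrow> ('k::{real_normed_field, euclidean_space}, 'u) nspace) \<Rightarrow> ((nat \<Rightarrow> 'u) \<Rightarrow> 'k) \<Rightarrow> bool" where
  "arens_attain_at_same_tuple N X \<Phi> \<longleftrightarrow>
     (\<exists>a''\<in>(\<Pi>\<^sub>E i\<in>{1..N}. unit_ball (dual (dual (X i)))).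
        \<forall>\<sigma>. \<sigma> permutes {1..N} \<longrightarrow> norm (arens_extension N X \<Phi> \<sigma> a'') = sup_norm N X \<Phi>)"

end

theory Submission
  imports Defs
begin

text \<open>
  Lindenstrauss' iteration. Starting from \<open>\<Phi>\<^sub>0\<close>, choose \<open>a\<^sub>n\<close> almost norming for \<open>\<Phi>\<^sub>n\<close> and put
  \<open>\<Phi>\<^sub>n\<^sub>+\<^sub>1 = \<Phi>\<^sub>n + \<epsilon>\<^sub>n (\<Sum> \<theta> \<Phi>\<^sub>n \<circ> A + \<beta>\<^sub>n \<Sum> \<theta> \<Phi>\<^sub>n \<circ> B)\<close> with scalars \<open>\<theta>\<close> of modulus at most one that
  align all values at \<open>a\<^sub>n\<close>. Here \<open>A\<close> runs over the operator tuples that replace one coordinate by \<open>f(\<cdot>) a\<^sub>n\<close>,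
  and \<open>B\<close> over those that replace one coordinate by \<open>f(\<cdot>) a\<^sub>i\<close> with \<open>i < n\<close> and another one by
  \<open>g(\<cdot>) a\<^sub>n\<close>, where \<open>f\<close>, \<open>g\<close> are normalised slices of \<open>\<Phi>\<^sub>n\<close> at \<open>a\<^sub>n\<close>; the operators are
  contractions, so the ideal property keeps the ideal norm of the perturbation small. Since
  \<open>\<Phi>\<^sub>n\<^sub>+\<^sub>1\<close> is almost normed by every \<open>a\<^sub>k\<close> with \<open>k > n\<close>, the defects
  \<open>\<parallel>\<Phi>\<^sub>n\<parallel> - \<bar>\<Phi>\<^sub>n(A a\<^sub>k)\<bar>\<close> and \<open>\<Sum>\<^sub>i\<^sub><\<^sub>n (\<parallel>\<Phi>\<^sub>n\<parallel> - \<bar>\<Phi>\<^sub>n(B a\<^sub>k)\<bar>)\<close> are hardly larger than at \<open>a\<^sub>n\<close>. The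
  \<open>A\<close>-defects are therefore summable over \<open>n\<close>, which bounds the sum of the \<open>B\<close>-defects over \<open>i < n\<close>
  by a constant independent of \<open>n\<close>. Consequently the limit form \<open>\<Phi>\<close> satisfies
  \<open>\<Sum>\<^sub>i (\<parallel>\<Phi>\<parallel> - lim\<^sub>n lim\<^sub>k \<bar>\<Phi>(a\<^sub>i, a\<^sub>n, a\<^sub>k)\<bar>) < \<infinity>\<close> along a free ultrafilter, in each of the six orders of
  the coordinates, so that every Arens extension has modulus \<open>\<parallel>\<Phi>\<parallel>\<close> at the weak-star limit of \<open>(a\<^sub>n)\<close>.
  Bounding a whole sum over \<open>i\<close> is essential: the value \<open>\<Phi>\<^sub>n(a\<^sub>i, a\<^sub>n, a\<^sub>n)\<close> may stay a fixed amount
  below \<open>\<parallel>\<Phi>\<parallel>\<close> as \<open>n\<close> grows, so a single \<open>i\<close> cannot be controlled this way.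
\<close>

subsection \<open>Normed spaces with explicit carrier\<close>

lemma scalar_ring_simps [simp]:
  "carrier scalar_ring = UNIV" "x \<otimes>\<^bsub>scalar_ring\<^esub> y = x * y" "\<one>\<^bsub>scalar_ring\<^esub> = 1"
  "\<zero>\<^bsub>scalar_ring\<^esub> = 0" "x \<oplus>\<^bsub>scalar_ring\<^esub> y = x + y"
  by (simp_all add: scalar_ring_def)

lemma cring_scalar_ring: "cring (scalar_ring :: 'k::{real_normed_field, euclidean_space} ring)"
proof (rule cringI)
  have "\<exists>y. y + x = 0" for x :: 'k
    by (rule exI[of _ "- x"]) simp
  then show "abelian_group (scalar_ring :: 'k ring)"
    by (intro abelian_groupI) (simp_all add: add_ac)
  show "comm_monoid (scalar_ring :: 'k ring)"
    by (rule comm_monoidI) (simp_all add: mult_ac)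
qed (simp add: distrib_right)

lemma a_inv_scalar_ring [simp]: "\<ominus>\<^bsub>scalar_ring\<^esub> (x :: 'k::{real_normed_field, euclidean_space}) = - x"
proof -
  interpret cring "scalar_ring :: 'k ring" by (rule cring_scalar_ring)
  show ?thesis using minus_equality[of "- x" x] by simp
qed

text \<open>Additive inverses come from the scalar -1 and \<open>nrm X \<zero> = 0\<close> from the
  scalar 0, which reduces the module axioms to plain vector space identities.\<close>

lemma normed_spaceI:
  fixes X :: "('k::{real_normed_field, euclidean_space}, 'u) nspace" (structure)
  assumes "\<And>x y. x \<in> carrier X \<Longrightarrow> y \<in> carrier X \<Longrightarrow> x \<oplus> y \<in> carrier X"
    and zero: "\<zero> \<in> carrier X"
    and smult: "\<And>a x. x \<in> carrier X \<Longrightarrow> a \<odot> x \<in> carrier X"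
    and "\<And>x y z. x \<in> carrier X \<Longrightarrow> y \<in> carrier X \<Longrightarrow> z \<in> carrier X \<Longrightarrow> (x \<oplus> y) \<oplus> z = x \<oplus> (y \<oplus> z)"
    and "\<And>x y. x \<in> carrier X \<Longrightarrow> y \<in> carrier X \<Longrightarrow> x \<oplus> y = y \<oplus> x"
    and "\<And>x. x \<in> carrier X \<Longrightarrow> \<zero> \<oplus> x = x"
    and zero_smult: "\<And>x. x \<in> carrier X \<Longrightarrow> 0 \<odot> x = \<zero>"
    and distr: "\<And>a b x. x \<in> carrier X \<Longrightarrow> (a + b) \<odot> x = a \<odot> x \<oplus> b \<odot> x"
    and "\<And>a x y. x \<in> carrier X \<Longrightarrow> y \<in> carrier X \<Longrightarrow> a \<odot> (x \<oplus> y) = a \<odot> x \<oplus> a \<odot> y"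
    and "\<And>a b x. x \<in> carrier X \<Longrightarrow> (a * b) \<odot> x = a \<odot> (b \<odot> x)"
    and one: "\<And>x. x \<in> carrier X \<Longrightarrow> 1 \<odot> x = x"
    and "\<And>x. x \<in> carrier X \<Longrightarrow> 0 \<le> nrm X x"
    and nrm0: "\<And>x. x \<in> carrier X \<Longrightarrow> nrm X x = 0 \<Longrightarrow> x = \<zero>"
    and nrm_smult: "\<And>a x. x \<in> carrier X \<Longrightarrow> nrm X (a \<odot> x) = norm a * nrm X x"
    and "\<And>x y. x \<in> carrier X \<Longrightarrow> y \<in> carrier X \<Longrightarrow> nrm X (x \<oplus> y) \<le> nrm X x + nrm X y"
  shows "normed_space X"
proof -
  have inv: "\<exists>y\<in>carrier X. y \<oplus> x = \<zero>" if x: "x \<in> carrier X" for x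
  proof
    show "(-1) \<odot> x \<oplus> x = \<zero>"
      using distr[OF x, of "-1" 1] by (simp add: one[OF x] zero_smult[OF x])
  qed (rule smult[OF x])
  have ab: "abelian_group X"
    by (rule abelian_groupI) (fact assms inv)+
  have "Module.module scalar_ring X"
    by (rule moduleI[OF cring_scalar_ring ab]) (simp_all, (fact assms)+)
  moreover have "nrm X \<zero> = 0"
    using nrm_smult[OF zero, of 0] zero_smult[OF zero] by simp
  ultimately show ?thesis
    unfolding normed_space_def normed_space_axioms_def
    using assms(12) nrm0 nrm_smult assms(15) by metis
qed

context normed_space
begin

lemma smult_closed' [simp, intro]: "x \<in> carrier X \<Longrightarrow> a \<odot> x \<in> carrier X"
  using smult_closed[of a x] by simp

lemma nrm_zero [simp]: "nrm X \<zero>\<^bsub>X\<^esub> = 0"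
  using nrm_eq_0_iff by auto

lemma zero_smult [simp]: "x \<in> carrier X \<Longrightarrow> 0 \<odot> x = \<zero>\<^bsub>X\<^esub>"
  using smult_l_null[of x] by simp

lemma one_smult [simp]: "x \<in> carrier X \<Longrightarrow> 1 \<odot> x = x"
  using smult_one[of x] by simp

lemma smult_add_left: "x \<in> carrier X \<Longrightarrow> (a + b) \<odot> x = a \<odot> x \<oplus>\<^bsub>X\<^esub> b \<odot> x"
  using smult_l_distr[of a b x] by simp

lemma smult_smult: "x \<in> carrier X \<Longrightarrow> a \<odot> (b \<odot> x) = (a * b) \<odot> x"
  using smult_assoc1[of a b x] by simp

lemma minus_eq_smult: "x \<in> carrier X \<Longrightarrow> \<ominus>\<^bsub>X\<^esub> x = (-1) \<odot> x"
  using smult_l_minus[of 1 x] by simp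

lemma diff_eq: "x \<in> carrier X \<Longrightarrow> y \<in> carrier X \<Longrightarrow> x \<ominus>\<^bsub>X\<^esub> y = x \<oplus>\<^bsub>X\<^esub> (-1) \<odot> y"
  by (simp add: a_minus_def minus_eq_smult)

lemma nrm_minus: "x \<in> carrier X \<Longrightarrow> nrm X (\<ominus>\<^bsub>X\<^esub> x) = nrm X x"
  by (simp add: minus_eq_smult nrm_smult)

sublocale metric: Metric_space "carrier X" "ndist X"
proof
  fix x y z
  show "0 \<le> ndist X x y" by (auto simp: ndist_def intro: nrm_nonneg)
  have "x \<ominus>\<^bsub>X\<^esub> y = \<ominus>\<^bsub>X\<^esub> (y \<ominus>\<^bsub>X\<^esub> x)" if "x \<in> carrier X" "y \<in> carrier X"
    using that M.a_comm by (simp add: a_minus_def M.minus_add)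
  then show "ndist X x y = ndist X y x"
    by (auto simp: ndist_def nrm_minus)
  show "(ndist X x y = 0) = (x = y)" if "x \<in> carrier X" "y \<in> carrier X"
    using that by (simp add: ndist_def nrm_eq_0_iff a_minus_def M.add.inv_solve_right')
  show "ndist X x z \<le> ndist X x y + ndist X y z"
    if xyz: "x \<in> carrier X" "y \<in> carrier X" "z \<in> carrier X"
  proof -
    have "x \<ominus>\<^bsub>X\<^esub> z = (x \<ominus>\<^bsub>X\<^esub> y) \<oplus>\<^bsub>X\<^esub> (y \<ominus>\<^bsub>X\<^esub> z)"
      using xyz by (simp add: a_minus_def M.a_assoc M.r_neg1)
    then show ?thesis using xyz nrm_triangle[of "x \<ominus>\<^bsub>X\<^esub> y" "y \<ominus>\<^bsub>X\<^esub> z"] by (simp add: ndist_def)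
  qed
qed

lemma ndist_smult: "x \<in> carrier X \<Longrightarrow> y \<in> carrier X \<Longrightarrow> ndist X x y = nrm X (x \<oplus>\<^bsub>X\<^esub> (-1) \<odot> y)"
  by (simp add: ndist_def diff_eq)

lemma zero_in_unit_ball: "\<zero>\<^bsub>X\<^esub> \<in> unit_ball X"
  by (simp add: unit_ball_def)

lemma continuous_map_norm_topology:
  fixes f :: "_ \<Rightarrow> 'c::metric_space"
  shows "continuous_map (norm_topology X) euclidean f \<longleftrightarrow>
    (\<forall>x\<in>carrier X. \<forall>e>0. \<exists>d>0. \<forall>y\<in>carrier X. nrm X (x \<ominus>\<^bsub>X\<^esub> y) < d \<longrightarrow> dist (f x) (f y) < e)"
proof -
  have "continuous_map (norm_topology X) euclidean f \<longleftrightarrow> continuous_map metric.mtopology Met_TC.mtopology f"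
    by (simp add: norm_topology_def)
  also have "\<dots> \<longleftrightarrow> (\<forall>a\<in>carrier X. \<forall>e>0. \<exists>d>0. \<forall>x. x \<in> carrier X \<and> ndist X a x < d \<longrightarrow> dist (f a) (f x) < e)"
    by (subst metric.metric_continuous_map[OF Met_TC.Metric_space_axioms]) simp
  also have "\<dots> \<longleftrightarrow> (\<forall>x\<in>carrier X. \<forall>e>0. \<exists>d>0. \<forall>y\<in>carrier X. nrm X (x \<ominus>\<^bsub>X\<^esub> y) < d \<longrightarrow> dist (f x) (f y) < e)"
    by (simp add: ndist_def Ball_def imp_conjL cong: imp_cong)
  finally show ?thesis .
qed

lemma linear_bounded_continuous:
  fixes f :: "_ \<Rightarrow> 'k"
  assumes add: "\<And>x y. x \<in> carrier X \<Longrightarrow> y \<in> carrier X \<Longrightarrow> f (x \<oplus>\<^bsub>X\<^esub> y) = f x + f y"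
    and smult: "\<And>a x. x \<in> carrier X \<Longrightarrow> f (a \<odot> x) = a * f x"
    and bound: "\<And>x. x \<in> carrier X \<Longrightarrow> norm (f x) \<le> C * nrm X x"
  shows "continuous_map (norm_topology X) euclidean f"
  unfolding continuous_map_norm_topology
proof (intro ballI allI impI)
  fix x and e :: real
  assume x: "x \<in> carrier X" and e: "e > 0"
  \<comment> \<open>Dividing by \<open>\<bar>C\<bar> + 1\<close> instead of \<open>C\<close> keeps
    the radius positive whatever the sign of \<open>C\<close>.\<close>
  have "dist (f x) (f y) < e" if y: "y \<in> carrier X" and d: "nrm X (x \<ominus>\<^bsub>X\<^esub> y) < e / (\<bar>C\<bar> + 1)" for y
  proof -
    have "dist (f x) (f y) = norm (f (x \<ominus>\<^bsub>X\<^esub> y))"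
      using x y by (simp add: diff_eq add smult dist_norm)
    also have "\<dots> \<le> C * nrm X (x \<ominus>\<^bsub>X\<^esub> y)"
      using x y by (intro bound) auto
    also have "\<dots> \<le> (\<bar>C\<bar> + 1) * nrm X (x \<ominus>\<^bsub>X\<^esub> y)"
      using x y by (intro mult_right_mono nrm_nonneg) auto
    also have "\<dots> < e"
      using d by (simp add: field_simps)
    finally show ?thesis .
  qed
  then show "\<exists>d>0. \<forall>y\<in>carrier X. nrm X (x \<ominus>\<^bsub>X\<^esub> y) < d \<longrightarrow> dist (f x) (f y) < e"
    using e by (intro exI[of _ "e / (\<bar>C\<bar> + 1)"]) auto
qed

lemma linear_continuous_bounded:
  fixes f :: "_ \<Rightarrow> 'k"
  assumes smult: "\<And>a x. x \<in> carrier X \<Longrightarrow> f (a \<odot> x) = a * f x"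
    and cont: "continuous_map (norm_topology X) euclidean f"
  shows "\<exists>C\<ge>0. \<forall>x\<in>carrier X. norm (f x) \<le> C * nrm X x"
proof -
  have f0: "f \<zero>\<^bsub>X\<^esub> = 0"
    using smult[of "\<zero>\<^bsub>X\<^esub>" 0] by simp
  obtain d where d: "d > 0" "\<And>y. y \<in> carrier X \<Longrightarrow> nrm X (\<zero>\<^bsub>X\<^esub> \<ominus>\<^bsub>X\<^esub> y) < d \<Longrightarrow> dist (f \<zero>\<^bsub>X\<^esub>) (f y) < 1"
    using cont[unfolded continuous_map_norm_topology, rule_format, of "\<zero>\<^bsub>X\<^esub>" 1] by auto
  have small: "norm (f y) < 1" if "y \<in> carrier X" "nrm X y < d" for y
    using d(2)[of y] that by (simp add: f0 a_minus_def nrm_minus)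
  show ?thesis
  proof (intro exI[of _ "2 / d"] conjI ballI)
    show "2 / d \<ge> 0" using d by simp
    fix x assume x: "x \<in> carrier X"
    show "norm (f x) \<le> 2 / d * nrm X x"
    proof (cases "nrm X x = 0")
      case True
      then show ?thesis using x by (simp add: nrm_eq_0_iff f0)
    next
      case False
      then have pos: "nrm X x > 0" using nrm_nonneg[OF x] by simp
      \<comment> \<open>This scalar brings \<open>x\<close> to norm d/2, inside the ball on which
        \<open>f\<close> is below 1; hence the constant \<open>2 / d\<close>.\<close>
      define a :: 'k where "a = of_real (d / (2 * nrm X x))"
      have na: "norm a = d / (2 * nrm X x)"
        unfolding a_def norm_of_real using pos d by simp
      have "norm (f (a \<odot> x)) < 1"
        using pos d x by (intro small) (auto simp: nrm_smult na)
      then show ?thesis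
        using x pos d by (simp add: smult norm_mult na field_simps)
    qed
  qed
qed

end

subsection \<open>Duals\<close>

lemma fun_space_simps [simp]:
  "carrier (fun_space A n) = A" "\<zero>\<^bsub>fun_space A n\<^esub> = (\<lambda>_. 0)"
  "f \<oplus>\<^bsub>fun_space A n\<^esub> g = (\<lambda>x. f x + g x)" "a \<odot>\<^bsub>fun_space A n\<^esub> f = (\<lambda>x. a * f x)"
  "nrm (fun_space A n) = n"
  by (simp_all add: fun_space_def)

lemma nrm_dual: "nrm (dual X) f = (SUP x\<in>unit_ball X. norm (f x))"
  and dual_ops [simp]: "\<zero>\<^bsub>dual X\<^esub> = (\<lambda>_. 0)" "f \<oplus>\<^bsub>dual X\<^esub> g = (\<lambda>x. f x + g x)" "a \<odot>\<^bsub>dual X\<^esub> f = (\<lambda>x. a * f x)"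
  by (simp_all add: dual_def)

context normed_space
begin

lemma dual_off: "f \<in> carrier (dual X) \<Longrightarrow> x \<notin> carrier X \<Longrightarrow> f x = 0"
  and dual_add: "f \<in> carrier (dual X) \<Longrightarrow> x \<in> carrier X \<Longrightarrow> y \<in> carrier X \<Longrightarrow> f (x \<oplus>\<^bsub>X\<^esub> y) = f x + f y"
  and dual_smult: "f \<in> carrier (dual X) \<Longrightarrow> x \<in> carrier X \<Longrightarrow> f (a \<odot> x) = a * f x"
  and dual_cont: "f \<in> carrier (dual X) \<Longrightarrow> continuous_map (norm_topology X) euclidean f"
  by (simp_all add: dual_def)

lemma dualI:
  fixes f :: "_ \<Rightarrow> 'k"
  assumes "\<And>x. x \<notin> carrier X \<Longrightarrow> f x = 0"
    and "\<And>x y. x \<in> carrier X \<Longrightarrow> y \<in> carrier X \<Longrightarrow> f (x \<oplus>\<^bsub>X\<^esub> y) = f x + f y"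
    and "\<And>a x. x \<in> carrier X \<Longrightarrow> f (a \<odot> x) = a * f x"
    and "\<And>x. x \<in> carrier X \<Longrightarrow> norm (f x) \<le> C * nrm X x"
  shows "f \<in> carrier (dual X)"
  using assms linear_bounded_continuous[of f C] by (simp add: dual_def)

lemma dual_norm_le:
  assumes "C \<ge> 0" "\<And>x. x \<in> carrier X \<Longrightarrow> norm (f x) \<le> C * nrm X x"
  shows "nrm (dual X) f \<le> C"
  unfolding nrm_dual
proof (rule cSUP_least)
  show "unit_ball X \<noteq> {}" using zero_in_unit_ball by blast
  fix x assume "x \<in> unit_ball X"
  then have x: "x \<in> carrier X" "nrm X x \<le> 1" by (auto simp: unit_ball_def)
  show "norm (f x) \<le> C"
    using assms(2)[OF x(1)] mult_left_mono[OF x(2) assms(1)] by simp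
qed

lemma dual_bdd:
  assumes "f \<in> carrier (dual X)"
  shows "bdd_above ((\<lambda>x. norm (f x)) ` unit_ball X)"
proof -
  have "\<exists>C\<ge>0. \<forall>x\<in>carrier X. norm (f x) \<le> C * nrm X x"
    by (rule linear_continuous_bounded) (simp_all add: dual_smult[OF assms] dual_cont[OF assms])
  then obtain C where C: "C \<ge> 0" "\<And>x. x \<in> carrier X \<Longrightarrow> norm (f x) \<le> C * nrm X x"
    by auto
  have "norm (f x) \<le> C" if "x \<in> unit_ball X" for x
    using C(2)[of x] mult_left_mono[of "nrm X x" 1 C] that C(1) by (simp add: unit_ball_def)
  then show ?thesis by (rule bdd_aboveI2)
qed

lemma dual_norm_nonneg: "f \<in> carrier (dual X) \<Longrightarrow> 0 \<le> nrm (dual X) f"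
  unfolding nrm_dual
  by (rule cSUP_upper2[where f = "\<lambda>x. norm (f x)" and x = "\<zero>\<^bsub>X\<^esub>"])
    (simp_all add: dual_bdd zero_in_unit_ball)

lemma dual_bound:
  assumes f: "f \<in> carrier (dual X)" and x: "x \<in> carrier X"
  shows "norm (f x) \<le> nrm (dual X) f * nrm X x"
proof (cases "nrm X x = 0")
  case True
  then have "x = 0 \<odot> x" using x by (simp add: nrm_eq_0_iff)
  then have "f x = 0" using dual_smult[OF f x, of 0] by simp
  then show ?thesis using True by simp
next
  case False
  then have pos: "nrm X x > 0" using nrm_nonneg[OF x] by simp
  define a :: 'k where "a = of_real (1 / nrm X x)"
  have na: "norm a = 1 / nrm X x"
    unfolding a_def norm_of_real using pos by simp
  have "a \<odot> x \<in> unit_ball X"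
    using x pos by (simp add: unit_ball_def nrm_smult na)
  then have "norm (f (a \<odot> x)) \<le> nrm (dual X) f"
    unfolding nrm_dual by (rule cSUP_upper[OF _ dual_bdd[OF f]])
  then show ?thesis
    using pos by (simp add: dual_smult[OF f x] norm_mult na field_simps)
qed

lemma normed_space_dual: "normed_space (dual X)"
proof (rule normed_spaceI)
  fix f g :: "_ \<Rightarrow> 'k" assume f: "f \<in> carrier (dual X)"
  show "0 \<le> nrm (dual X) f" by (rule dual_norm_nonneg[OF f])
  show "f = \<zero>\<^bsub>dual X\<^esub>" if "nrm (dual X) f = 0"
  proof
    fix x
    show "f x = \<zero>\<^bsub>dual X\<^esub> x"
      using dual_bound[OF f, of x] dual_off[OF f, of x] that by (cases "x \<in> carrier X") auto
  qed
  fix a :: 'k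
  have bound: "norm (a * f x) \<le> norm a * nrm (dual X) f * nrm X x" if "x \<in> carrier X" for a x
    using mult_left_mono[OF dual_bound[OF f that] norm_ge_zero[of a]] by (simp add: norm_mult mult.assoc)
  show mem: "a \<odot>\<^bsub>dual X\<^esub> f \<in> carrier (dual X)" for a
    unfolding dual_ops
    by (rule dualI[OF _ _ _ bound])
      (simp_all add: dual_off[OF f] dual_add[OF f] dual_smult[OF f] distrib_left)
  have le: "nrm (dual X) (\<lambda>x. a * f x) \<le> norm a * nrm (dual X) f" for a
    by (rule dual_norm_le) (simp_all add: bound dual_norm_nonneg[OF f])
  show "nrm (dual X) (a \<odot>\<^bsub>dual X\<^esub> f) = norm a * nrm (dual X) f"
  proof (cases "a = 0")
    case True
    have "nrm (dual X) (\<lambda>x. 0) \<le> 0" by (rule dual_norm_le) simp_all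
    moreover have "0 \<le> nrm (dual X) (\<lambda>x. 0)" using dual_norm_nonneg[OF mem[of 0]] by simp
    ultimately show ?thesis using True by simp
  next
    case False
    \<comment> \<open>Undoing the multiplication by \<open>a\<close> gives the reverse of
      \<open>le\<close>.\<close>
    have "norm (f x) \<le> nrm (dual X) (\<lambda>x. a * f x) / norm a * nrm X x" if "x \<in> carrier X" for x
      using dual_bound[OF mem[of a] that] False by (simp add: norm_mult field_simps)
    then have "nrm (dual X) f \<le> nrm (dual X) (\<lambda>x. a * f x) / norm a"
      using dual_norm_nonneg[OF mem[of a]] by (intro dual_norm_le) simp_all
    then show ?thesis using le[of a] False by (simp add: field_simps)
  qed
  assume g: "g \<in> carrier (dual X)"
  have sum: "norm (f x + g x) \<le> (nrm (dual X) f + nrm (dual X) g) * nrm X x" if "x \<in> carrier X" for x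
    using norm_triangle_ineq[of "f x" "g x"] dual_bound[OF f that] dual_bound[OF g that]
    by (simp add: algebra_simps)
  show "f \<oplus>\<^bsub>dual X\<^esub> g \<in> carrier (dual X)"
    unfolding dual_ops
    by (rule dualI[OF _ _ _ sum])
      (simp_all add: dual_off[OF f] dual_off[OF g] dual_add[OF f] dual_add[OF g]
        dual_smult[OF f] dual_smult[OF g] distrib_left)
  show "nrm (dual X) (f \<oplus>\<^bsub>dual X\<^esub> g) \<le> nrm (dual X) f + nrm (dual X) g"
    using dual_norm_le[OF _ sum] dual_norm_nonneg[OF f] dual_norm_nonneg[OF g] by simp
next
  show "\<zero>\<^bsub>dual X\<^esub> \<in> carrier (dual X)"
    by (rule dualI[where C = 0]) simp_all
qed (simp_all add: algebra_simps fun_eq_iff)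

end

subsection \<open>The scalar field as a Banach space\<close>

lemma scalar_space_simps [simp]:
  "carrier scalar_space = range Inl" "\<zero>\<^bsub>scalar_space\<^esub> = Inl 0"
  "x \<oplus>\<^bsub>scalar_space\<^esub> y = Inl (projl x + projl y)" "a \<odot>\<^bsub>scalar_space\<^esub> x = Inl (a * projl x)"
  "nrm scalar_space x = norm (projl x)"
  by (simp_all add: scalar_space_def)

text \<open>The map \<open>Inl\<close> is an isometry from the field, which is complete as a
  Euclidean space.\<close>

lemma banach_space_scalar_space:
  "banach_space (scalar_space :: ('k::{real_normed_field, euclidean_space}, 'k + 'u) nspace)"
proof -
  let ?S = "scalar_space :: ('k, 'k + 'u) nspace"
  interpret S: normed_space ?S
    by (rule normed_spaceI) (auto simp: distrib_left distrib_right norm_mult norm_triangle_ineq)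
  have dist: "ndist ?S (Inl a) (Inl b) = dist a b" for a b
    by (simp add: S.ndist_smult dist_norm)
  have "\<exists>x. limitin S.metric.mtopology s x sequentially" if "S.metric.MCauchy s" for s
  proof -
    from that have ran: "range s \<subseteq> carrier ?S"
      and cau: "\<And>e. e > 0 \<Longrightarrow> \<exists>M. \<forall>n n'. M \<le> n \<longrightarrow> M \<le> n' \<longrightarrow> ndist ?S (s n) (s n') < e"
      unfolding S.metric.MCauchy_def by blast+
    have s: "s n = Inl (projl (s n))" for n
      using subsetD[OF ran rangeI[of s n]] by auto
    have dist_s: "ndist ?S (s n) (Inl b) = dist (projl (s n)) b" for n b
      using dist[of "projl (s n)" b] by (simp add: s[symmetric])
    have dist_ss: "ndist ?S (s n) (s m) = dist (projl (s n)) (projl (s m))" for n m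
      using dist_s[of n "projl (s m)"] by (simp add: s[symmetric])
    have "Cauchy (\<lambda>n. projl (s n))"
      unfolding Cauchy_def using cau by (simp add: dist_ss)
    then obtain l where "(\<lambda>n. projl (s n)) \<longlonglongrightarrow> l"
      by (meson Cauchy_convergent_iff convergentD)
    then have lim: "\<forall>\<^sub>F n in sequentially. dist (projl (s n)) l < e" if "e > 0" for e
      using that by (rule tendstoD)
    have "limitin S.metric.mtopology s (Inl l) sequentially"
      unfolding S.metric.limitin_metric
    proof (intro conjI allI impI)
      show "Inl l \<in> carrier ?S" by simp
      fix e :: real assume "e > 0"
      from lim[OF this] show "\<forall>\<^sub>F n in sequentially. s n \<in> carrier ?S \<and> ndist ?S (s n) (Inl l) < e"
        by eventually_elim (use ran dist_s in fastforce)
    qed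
    then show ?thesis ..
  qed
  then have compl: "S.metric.mcomplete"
    unfolding S.metric.mcomplete_def by simp
  show ?thesis
    by (rule banach_space.intro[OF S.normed_space_axioms banach_space_axioms.intro[OF compl]])
qed

subsection \<open>Multilinear forms and ideals\<close>

lemma tuplesI: "(\<And>i. i \<in> {1..N} \<Longrightarrow> x i \<in> carrier (X i)) \<Longrightarrow> x \<in> extensional {1..N} \<Longrightarrow> x \<in> tuples N X"
  by (auto simp: tuples_def PiE_iff)

lemma tuplesD: "x \<in> tuples N X \<Longrightarrow> i \<in> {1..N} \<Longrightarrow> x i \<in> carrier (X i)"
  by (auto simp: tuples_def)

lemma tuples_upd: "x \<in> tuples N X \<Longrightarrow> i \<in> {1..N} \<Longrightarrow> u \<in> carrier (X i) \<Longrightarrow> x(i := u) \<in> tuples N X"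
  by (auto simp: tuples_def PiE_iff extensional_def)

lemma multilinear_add: "\<Phi> \<in> multilinear_forms N X \<Longrightarrow> x \<in> tuples N X \<Longrightarrow> i \<in> {1..N} \<Longrightarrow>
    u \<in> carrier (X i) \<Longrightarrow> v \<in> carrier (X i) \<Longrightarrow> \<Phi> (x(i := u \<oplus>\<^bsub>X i\<^esub> v)) = \<Phi> (x(i := u)) + \<Phi> (x(i := v))"
  and multilinear_smult: "\<Phi> \<in> multilinear_forms N X \<Longrightarrow> x \<in> tuples N X \<Longrightarrow> i \<in> {1..N} \<Longrightarrow>
    u \<in> carrier (X i) \<Longrightarrow> \<Phi> (x(i := a \<odot>\<^bsub>X i\<^esub> u)) = a * \<Phi> (x(i := u))"
  by (simp_all add: multilinear_forms_def)

text \<open>Scalars are pulled out one coordinate at a time, by induction on the set of scaled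
  coordinates.\<close>

lemma multilinear_scale:
  assumes \<Phi>: "\<Phi> \<in> multilinear_forms N X" and x: "x \<in> tuples N X"
    and X: "\<And>i. i \<in> {1..N} \<Longrightarrow> normed_space (X i)"
    and "I \<subseteq> {1..N}"
  shows "\<Phi> (\<lambda>i. if i \<in> I then a i \<odot>\<^bsub>X i\<^esub> x i else x i) = (\<Prod>i\<in>I. a i) * \<Phi> x"
proof -
  have "finite I" using \<open>I \<subseteq> {1..N}\<close> finite_subset by blast
  then show ?thesis using \<open>I \<subseteq> {1..N}\<close>
  proof (induction I)
    case empty
    then show ?case by simp
  next
    case (insert j I)
    let ?y = "\<lambda>i. if i \<in> I then a i \<odot>\<^bsub>X i\<^esub> x i else x i"
    have j: "j \<in> {1..N}" and xj: "x j \<in> carrier (X j)"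
      using insert.prems x by (auto intro: tuplesD)
    have y: "?y \<in> tuples N X"
      using x insert.prems tuplesD[OF x] normed_space.smult_closed'[OF X]
      by (intro tuplesI) (auto simp: tuples_def PiE_iff extensional_def subset_iff)
    have "(\<lambda>i. if i \<in> insert j I then a i \<odot>\<^bsub>X i\<^esub> x i else x i) = ?y(j := a j \<odot>\<^bsub>X j\<^esub> x j)"
      using insert.hyps by auto
    moreover have "\<Phi> (?y(j := a j \<odot>\<^bsub>X j\<^esub> x j)) = a j * \<Phi> (?y(j := x j))"
      by (rule multilinear_smult[OF \<Phi> y j xj])
    moreover have "?y(j := x j) = ?y"
      using insert.hyps by auto
    ultimately show ?case
      using insert by (simp add: mult.assoc)
  qed
qed

lemma operator_norm_bounds:
  assumes Z: "normed_space Z" and X: "normed_space X" and T: "T \<in> carrier Z \<rightarrow> carrier X" and C: "C \<ge> 0"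
    and bound: "\<And>z. z \<in> carrier Z \<Longrightarrow> nrm X (T z) \<le> C * nrm Z z"
  shows "0 \<le> operator_norm Z X T" "operator_norm Z X T \<le> C"
proof -
  have le: "nrm X (T z) \<le> C" if "z \<in> unit_ball Z" for z
    using bound[of z] mult_left_mono[of "nrm Z z" 1 C] C that by (simp add: unit_ball_def)
  have 0: "\<zero>\<^bsub>Z\<^esub> \<in> unit_ball Z" by (rule normed_space.zero_in_unit_ball[OF Z])
  show "operator_norm Z X T \<le> C"
    unfolding operator_norm_def using le 0 by (intro cSUP_least) auto
  have 1: "0 \<le> nrm X (T \<zero>\<^bsub>Z\<^esub>)"
    using T 0 by (intro normed_space.nrm_nonneg[OF X]) (auto simp: unit_ball_def)
  have "bdd_above ((\<lambda>z. nrm X (T z)) ` unit_ball Z)"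
    by (rule bdd_aboveI2[of _ _ C]) (rule le)
  then show "0 \<le> operator_norm Z X T"
    unfolding operator_norm_def by (rule cSUP_upper2) (rule 0, rule 1)
qed

text \<open>The bound is pointwise, from which \<open>operator_norm_bounds\<close> yields the
  operator norm; products of operator norms are then at most one.\<close>

definition contraction :: "('k::{real_normed_field, euclidean_space}, 'u) nspace \<Rightarrow> ('u \<Rightarrow> 'u) \<Rightarrow> bool" where
  "contraction X T \<longleftrightarrow> bounded_operator X X T \<and> (\<forall>z\<in>carrier X. nrm X (T z) \<le> nrm X z)"

text \<open>The scalar is the phase of \<open>p\<close> divided by the phase of \<open>q\<close>, so
  that both summands point in the same direction. If one of them vanishes, 1 does.\<close>

lemma aligning_scalar:
  fixes p q :: "'k::real_normed_field"
  obtains \<theta> where "norm \<theta> \<le> 1" "norm (p + \<theta> * q) = norm p + norm q"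
proof (cases "p = 0 \<or> q = 0")
  case True
  then show thesis by (intro that[of 1]) auto
next
  case False
  define \<theta> where "\<theta> = (p / of_real (norm p)) * (of_real (norm q) / q)"
  have "norm \<theta> = 1" using False by (simp add: \<theta>_def norm_mult norm_divide)
  moreover have "p + \<theta> * q = (p / of_real (norm p)) * of_real (norm p + norm q)"
    using False by (simp add: \<theta>_def field_simps)
  then have "norm (p + \<theta> * q) = norm p + norm q"
    using False by (simp add: norm_mult norm_divide del: of_real_add)
  ultimately show thesis by (intro that) auto
qed

section \<open>Ideal norm estimates and aligned sums of composed forms\<close>

context normed_ideal
begin

lemma normed_component: "X \<in> banach_tuples N \<Longrightarrow> i \<in> {1..N} \<Longrightarrow> normed_space (X i)"
  using PiE_mem[of X "{1..N}" "\<lambda>_. {X. banach_space X}" i]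
  by (auto simp: banach_tuples_def dest: banach_space.axioms(1))

lemma multilinear: "X \<in> banach_tuples N \<Longrightarrow> \<Phi> \<in> U X \<Longrightarrow> \<Phi> \<in> multilinear_forms N X"
  using forms by blast

lemma U_zero: "X \<in> banach_tuples N \<Longrightarrow> (\<lambda>_. 0) \<in> U X"
  and U_add: "X \<in> banach_tuples N \<Longrightarrow> \<Phi> \<in> U X \<Longrightarrow> \<Psi> \<in> U X \<Longrightarrow> (\<lambda>x. \<Phi> x + \<Psi> x) \<in> U X"
  and U_smult: "X \<in> banach_tuples N \<Longrightarrow> \<Phi> \<in> U X \<Longrightarrow> (\<lambda>x. c * \<Phi> x) \<in> U X"
  and nU_nonneg: "X \<in> banach_tuples N \<Longrightarrow> \<Phi> \<in> U X \<Longrightarrow> 0 \<le> nU X \<Phi>"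
  and nU_smult: "X \<in> banach_tuples N \<Longrightarrow> \<Phi> \<in> U X \<Longrightarrow> nU X (\<lambda>x. c * \<Phi> x) = norm c * nU X \<Phi>"
  and nU_triangle: "X \<in> banach_tuples N \<Longrightarrow> \<Phi> \<in> U X \<Longrightarrow> \<Psi> \<in> U X \<Longrightarrow>
    nU X (\<lambda>x. \<Phi> x + \<Psi> x) \<le> nU X \<Phi> + nU X \<Psi>"
proof -
  assume X: "X \<in> banach_tuples N"
  interpret V: normed_space "fun_space (U X) (nU X)" by (rule normed[OF X])
  show "(\<lambda>_. 0) \<in> U X" using V.M.zero_closed by simp
  assume \<Phi>: "\<Phi> \<in> U X"
  show "(\<lambda>x. c * \<Phi> x) \<in> U X" using V.smult_closed'[of \<Phi> c] \<Phi> by simp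
  show "0 \<le> nU X \<Phi>" using V.nrm_nonneg[of \<Phi>] \<Phi> by simp
  show "nU X (\<lambda>x. c * \<Phi> x) = norm c * nU X \<Phi>" using V.nrm_smult[of \<Phi> c] \<Phi> by simp
  assume \<Psi>: "\<Psi> \<in> U X"
  show "(\<lambda>x. \<Phi> x + \<Psi> x) \<in> U X" using V.M.a_closed[of \<Phi> \<Psi>] \<Phi> \<Psi> by simp
  show "nU X (\<lambda>x. \<Phi> x + \<Psi> x) \<le> nU X \<Phi> + nU X \<Psi>" using V.nrm_triangle[of \<Phi> \<Psi>] \<Phi> \<Psi> by simp
qed

lemma U_diff: "X \<in> banach_tuples N \<Longrightarrow> \<Phi> \<in> U X \<Longrightarrow> \<Psi> \<in> U X \<Longrightarrow> (\<lambda>x. \<Phi> x - \<Psi> x) \<in> U X"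
  using U_add[of X \<Phi> "\<lambda>x. (-1) * \<Psi> x"] U_smult[of X \<Psi> "-1"] by simp

lemma nU_diff_triangle:
  "X \<in> banach_tuples N \<Longrightarrow> \<Phi> \<in> U X \<Longrightarrow> \<Psi> \<in> U X \<Longrightarrow> \<Xi> \<in> U X \<Longrightarrow>
    nU X (\<lambda>x. \<Phi> x - \<Xi> x) \<le> nU X (\<lambda>x. \<Phi> x - \<Psi> x) + nU X (\<lambda>x. \<Psi> x - \<Xi> x)"
  using nU_triangle[OF _ U_diff U_diff, of X \<Phi> \<Psi> \<Psi> \<Xi>] by simp

lemma nU_diff_commute:
  "X \<in> banach_tuples N \<Longrightarrow> \<Phi> \<in> U X \<Longrightarrow> \<Psi> \<in> U X \<Longrightarrow> nU X (\<lambda>x. \<Phi> x - \<Psi> x) = nU X (\<lambda>x. \<Psi> x - \<Phi> x)"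
  using nU_smult[OF _ U_diff, of X \<Phi> \<Psi> "-1"] by simp

text \<open>Composing \<open>\<Phi>\<close> with the operators that send a scalar z to z times
  \<open>x i\<close> gives \<open>\<Phi> x\<close> times the product form. That form has ideal norm
  one and the operators have norm at most \<open>nrm (X i) (x i)\<close>, so the ideal inequality
  turns into the estimate.\<close>

lemma form_bound:
  assumes X: "X \<in> banach_tuples N" and \<Phi>: "\<Phi> \<in> U X" and x: "x \<in> tuples N X"
  shows "norm (\<Phi> x) \<le> nU X \<Phi> * (\<Prod>i=1..N. nrm (X i) (x i))"
proof -
  let ?Z = "\<lambda>i\<in>{1..N}. scalar_space :: ('k, 'k + 'u) nspace"
  let ?T = "\<lambda>i (z :: 'k + 'u). projl z \<odot>\<^bsub>X i\<^esub> x i"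
  have Z: "?Z \<in> banach_tuples N"
    unfolding banach_tuples_def
    by (simp add: banach_space_scalar_space del: One_nat_def)
  have XN: "normed_space (X i)" and xi: "x i \<in> carrier (X i)" if "i \<in> {1..N}" for i
    using that normed_component[OF X] tuplesD[OF x] by auto
  have T: "bounded_operator (?Z i) (X i) (?T i)"
    and nT: "0 \<le> operator_norm (?Z i) (X i) (?T i)" "operator_norm (?Z i) (X i) (?T i) \<le> nrm (X i) (x i)"
    if i: "i \<in> {1..N}" for i
  proof -
    interpret normed_space "X i" by (rule XN[OF i])
    note xi[OF i, simp]
    have maps: "?T i \<in> carrier (?Z i) \<rightarrow> carrier (X i)" by simp
    have bound: "nrm (X i) (?T i z) \<le> nrm (X i) (x i) * nrm (?Z i) z" for z
      using i by (simp add: nrm_smult del: One_nat_def)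
    show "bounded_operator (?Z i) (X i) (?T i)"
      unfolding bounded_operator_def
    proof (intro conjI exI[of _ "nrm (X i) (x i)"])
      show "\<forall>z\<in>carrier (?Z i). nrm (X i) (?T i z) \<le> nrm (X i) (x i) * nrm (?Z i) z"
        using bound by blast
    qed (use i maps in \<open>auto simp: smult_add_left smult_smult simp del: One_nat_def\<close>)
    have "normed_space (?Z i)"
      using i banach_space.axioms(1)[OF banach_space_scalar_space] by simp
    then show "0 \<le> operator_norm (?Z i) (X i) (?T i)" "operator_norm (?Z i) (X i) (?T i) \<le> nrm (X i) (x i)"
      using operator_norm_bounds[OF _ XN[OF i] maps _ bound] nrm_nonneg[OF xi[OF i]] by auto
  qed
  \<comment> \<open>The restricted and the constant family of scalar spaces differ off
    \<open>{1..N}\<close> but have the same tuples.\<close>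
  have tup: "tuples N ?Z = tuples N (\<lambda>_. scalar_space)"
    by (auto simp: tuples_def intro!: PiE_cong simp del: One_nat_def)
  have eq: "compose_form N ?Z \<Phi> ?T = (\<lambda>z. \<Phi> x * scalar_product_form N z)"
  proof
    fix z
    have eq: "(\<lambda>i\<in>{1..N}. ?T i (z i)) = (\<lambda>i. if i \<in> {1..N} then projl (z i) \<odot>\<^bsub>X i\<^esub> x i else x i)"
    proof
      fix i show "(\<lambda>i\<in>{1..N}. ?T i (z i)) i = (if i \<in> {1..N} then projl (z i) \<odot>\<^bsub>X i\<^esub> x i else x i)"
        using PiE_arb[OF x[unfolded tuples_def], of i] by (simp add: restrict_def)
    qed
    have "\<Phi> (\<lambda>i\<in>{1..N}. ?T i (z i)) = (\<Prod>i=1..N. projl (z i)) * \<Phi> x"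
      unfolding eq by (rule multilinear_scale[OF multilinear[OF X \<Phi>] x XN subset_refl])
    then show "compose_form N ?Z \<Phi> ?T z = \<Phi> x * scalar_product_form N z"
      unfolding compose_form_def scalar_product_form_def tup by simp
  qed
  have "norm (\<Phi> x) = nU ?Z (compose_form N ?Z \<Phi> ?T)"
    unfolding eq nU_smult[OF Z product_mem] product_norm by simp
  also have "\<dots> \<le> nU X \<Phi> * (\<Prod>i=1..N. operator_norm (?Z i) (X i) (?T i))"
    by (rule compose_norm[OF X Z T \<Phi>])
  also have "\<dots> \<le> nU X \<Phi> * (\<Prod>i=1..N. nrm (X i) (x i))"
    by (intro mult_left_mono prod_mono conjI nT nU_nonneg[OF X \<Phi>])
  finally show ?thesis .
qed

lemma compose_contraction:
  assumes X: "X \<in> banach_tuples N" and \<Phi>: "\<Phi> \<in> U X"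
    and T: "\<And>i. i \<in> {1..N} \<Longrightarrow> contraction (X i) (T i)"
  shows "compose_form N X \<Phi> T \<in> U X" "nU X (compose_form N X \<Phi> T) \<le> nU X \<Phi>"
proof -
  have T': "bounded_operator (X i) (X i) (T i)" if "i \<in> {1..N}" for i
    using T[OF that] by (simp add: contraction_def)
  show "compose_form N X \<Phi> T \<in> U X"
    by (rule compose_mem[OF X X T' \<Phi>])
  have "operator_norm (X i) (X i) (T i) \<in> {0..1}" if i: "i \<in> {1..N}" for i
    using operator_norm_bounds[OF normed_component[OF X i] normed_component[OF X i], of "T i" 1] T[OF i]
    by (auto simp: contraction_def bounded_operator_def)
  then have "(\<Prod>i=1..N. operator_norm (X i) (X i) (T i)) \<le> 1"
    by (intro prod_le_1) auto
  then have "nU X \<Phi> * (\<Prod>i=1..N. operator_norm (X i) (X i) (T i)) \<le> nU X \<Phi> * 1"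
    by (intro mult_left_mono nU_nonneg[OF X \<Phi>])
  then show "nU X (compose_form N X \<Phi> T) \<le> nU X \<Phi>"
    using compose_norm[OF X X T' \<Phi>] by simp
qed

text \<open>The composed forms are added one by one, each with a scalar that aligns its value at
  \<open>a\<close> with the sum built so far. The triangle inequality is then an equality at
  \<open>a\<close> and remains an upper bound elsewhere, while each summand has ideal norm at most
  \<open>w j * nU X \<Phi>\<close>.\<close>

lemma aligned_perturbation:
  assumes X: "X \<in> banach_tuples N" and \<Phi>: "\<Phi> \<in> U X" and a: "a \<in> tuples N X" and "finite J"
    and T: "\<And>j i. j \<in> J \<Longrightarrow> i \<in> {1..N} \<Longrightarrow> contraction (X i) (T j i)"
    and w: "\<And>j. j \<in> J \<Longrightarrow> 0 \<le> w j"
  shows "\<exists>\<Psi>\<in>U X. nU X (\<lambda>x. \<Psi> x - \<Phi> x) \<le> (\<Sum>j\<in>J. w j) * nU X \<Phi> \<and>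
    norm (\<Psi> a) = norm (\<Phi> a) + (\<Sum>j\<in>J. w j * norm (compose_form N X \<Phi> (T j) a)) \<and>
    (\<forall>x. norm (\<Psi> x) \<le> norm (\<Phi> x) + (\<Sum>j\<in>J. w j * norm (compose_form N X \<Phi> (T j) x)))"
  using \<open>finite J\<close> T w
proof (induction J)
  case empty
  show ?case
    using \<Phi> nU_smult[OF X U_zero[OF X], of 0] by (intro bexI[of _ \<Phi>]) auto
next
  case (insert j J)
  then obtain \<Psi> where \<Psi>: "\<Psi> \<in> U X" "nU X (\<lambda>x. \<Psi> x - \<Phi> x) \<le> (\<Sum>j\<in>J. w j) * nU X \<Phi>"
    "norm (\<Psi> a) = norm (\<Phi> a) + (\<Sum>j\<in>J. w j * norm (compose_form N X \<Phi> (T j) a))"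
    "\<And>x. norm (\<Psi> x) \<le> norm (\<Phi> x) + (\<Sum>j\<in>J. w j * norm (compose_form N X \<Phi> (T j) x))"
    by auto
  let ?C = "compose_form N X \<Phi> (T j)"
  have wj: "0 \<le> w j" using insert.prems by simp
  have C: "?C \<in> U X" "nU X ?C \<le> nU X \<Phi>"
    using compose_contraction[OF X \<Phi>] insert.prems(1) by auto
  obtain \<theta> where \<theta>: "norm \<theta> \<le> 1" "norm (\<Psi> a + \<theta> * (of_real (w j) * ?C a)) = norm (\<Psi> a) + norm (of_real (w j) * ?C a)"
    by (rule aligning_scalar)
  let ?c = "\<theta> * of_real (w j)"
  have c: "norm ?c \<le> w j"
    using \<theta>(1) wj mult_right_mono[of "norm \<theta>" 1 "w j"] by (simp add: norm_mult)
  show ?case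
  proof (intro bexI[of _ "\<lambda>x. \<Psi> x + ?c * ?C x"] conjI allI)
    show "(\<lambda>x. \<Psi> x + ?c * ?C x) \<in> U X"
      by (intro U_add U_smult X \<Psi> C)
    have "nU X (\<lambda>x. (\<Psi> x - \<Phi> x) + ?c * ?C x) \<le> nU X (\<lambda>x. \<Psi> x - \<Phi> x) + norm ?c * nU X ?C"
      using nU_triangle[OF X U_diff[OF X \<Psi>(1) \<Phi>] U_smult[OF X C(1)]] nU_smult[OF X C(1)] by simp
    also have "\<dots> \<le> (\<Sum>j\<in>J. w j) * nU X \<Phi> + w j * nU X \<Phi>"
      by (intro add_mono \<Psi> mult_mono c C wj nU_nonneg[OF X C(1)])
    finally show "nU X (\<lambda>x. \<Psi> x + ?c * ?C x - \<Phi> x) \<le> (\<Sum>j\<in>insert j J. w j) * nU X \<Phi>"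
      using insert.hyps by (simp add: algebra_simps)
    show "norm (\<Psi> a + ?c * ?C a) = norm (\<Phi> a) + (\<Sum>j\<in>insert j J. w j * norm (compose_form N X \<Phi> (T j) a))"
      using insert.hyps \<theta>(2) \<Psi>(3) wj by (simp add: mult.assoc norm_mult)
    fix x
    have "norm (\<Psi> x + ?c * ?C x) \<le> norm (\<Psi> x) + norm ?c * norm (?C x)"
      by (metis norm_triangle_ineq norm_mult)
    also have "\<dots> \<le> norm (\<Psi> x) + w j * norm (?C x)"
      by (intro add_left_mono mult_right_mono c) auto
    finally show "norm (\<Psi> x + ?c * ?C x) \<le> norm (\<Phi> x) + (\<Sum>j\<in>insert j J. w j * norm (compose_form N X \<Phi> (T j) x))"
      using insert.hyps \<Psi>(4)[of x] by simp
  qed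
qed

end

subsection \<open>The perturbation step\<close>

definition ball_tuples :: "nat \<Rightarrow> (nat \<Rightarrow> ('k::{real_normed_field, euclidean_space}, 'u) nspace) \<Rightarrow> (nat \<Rightarrow> 'u) set" where
  "ball_tuples N X = (\<Pi>\<^sub>E i\<in>{1..N}. unit_ball (X i))"

lemma ball_tuples_tuples: "x \<in> ball_tuples N X \<Longrightarrow> x \<in> tuples N X"
  by (auto simp: ball_tuples_def tuples_def unit_ball_def PiE_iff)

lemma ball_tuplesD: "x \<in> ball_tuples N X \<Longrightarrow> i \<in> {1..N} \<Longrightarrow> x i \<in> unit_ball (X i)"
  by (auto simp: ball_tuples_def)

lemma ball_tuples_upd: "x \<in> ball_tuples N X \<Longrightarrow> i \<in> {1..N} \<Longrightarrow> u \<in> unit_ball (X i) \<Longrightarrow> x(i := u) \<in> ball_tuples N X"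
  by (auto simp: ball_tuples_def PiE_iff extensional_def)

lemma contraction_id: "normed_space X \<Longrightarrow> contraction X (\<lambda>z. z)"
  by (auto simp: contraction_def bounded_operator_def intro: exI[of _ 1])

lemma contraction_rank_one:
  assumes "normed_space X" and b: "b \<in> unit_ball X"
    and add: "\<And>x y. x \<in> carrier X \<Longrightarrow> y \<in> carrier X \<Longrightarrow> f (x \<oplus>\<^bsub>X\<^esub> y) = f x + f y"
    and smult: "\<And>a x. x \<in> carrier X \<Longrightarrow> f (a \<odot>\<^bsub>X\<^esub> x) = a * f x"
    and bound: "\<And>x. x \<in> carrier X \<Longrightarrow> norm (f x) \<le> nrm X x"
  shows "contraction X (\<lambda>z. f z \<odot>\<^bsub>X\<^esub> b)"
proof -
  interpret normed_space X by fact
  have b: "b \<in> carrier X" "nrm X b \<le> 1" using b by (auto simp: unit_ball_def)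
  have le: "nrm X (f z \<odot>\<^bsub>X\<^esub> b) \<le> nrm X z" if "z \<in> carrier X" for z
    using mult_mono[OF bound[OF that] b(2)] nrm_nonneg[OF b(1)] nrm_nonneg[OF that] b by (simp add: nrm_smult)
  have "\<exists>C. \<forall>z\<in>carrier X. nrm X (f z \<odot>\<^bsub>X\<^esub> b) \<le> C * nrm X z"
    using le by (intro exI[of _ 1]) simp
  then show ?thesis
    using b le by (auto simp: contraction_def bounded_operator_def add smult smult_add_left smult_smult)
qed

context normed_ideal
begin

lemma form_bound_ball:
  assumes X: "X \<in> banach_tuples N" and \<Phi>: "\<Phi> \<in> U X" and x: "x \<in> ball_tuples N X"
  shows "norm (\<Phi> x) \<le> nU X \<Phi>"
proof -
  have "nrm (X i) (x i) \<in> {0..1}" if "i \<in> {1..N}" for i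
    using ball_tuplesD[OF x that] normed_space.nrm_nonneg[OF normed_component[OF X that]]
    by (auto simp: unit_ball_def)
  then have "(\<Prod>i=1..N. nrm (X i) (x i)) \<le> 1"
    by (intro prod_le_1) auto
  then have "nU X \<Phi> * (\<Prod>i=1..N. nrm (X i) (x i)) \<le> nU X \<Phi> * 1"
    by (intro mult_left_mono nU_nonneg[OF X \<Phi>])
  then show ?thesis
    using form_bound[OF X \<Phi> ball_tuples_tuples[OF x]] by simp
qed

lemma ball_tuples_nonempty: "X \<in> banach_tuples N \<Longrightarrow> ball_tuples N X \<noteq> {}"
  unfolding ball_tuples_def PiE_eq_empty_iff
  using normed_space.zero_in_unit_ball[OF normed_component] by blast

lemma sup_norm_upper:
  assumes X: "X \<in> banach_tuples N" and \<Phi>: "\<Phi> \<in> U X" and x: "x \<in> ball_tuples N X"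
  shows "norm (\<Phi> x) \<le> sup_norm N X \<Phi>"
  unfolding sup_norm_def ball_tuples_def[symmetric]
  by (rule cSUP_upper[OF x bdd_aboveI2[OF form_bound_ball[OF X \<Phi>]]])

lemma sup_norm_least:
  assumes X: "X \<in> banach_tuples N" and "\<And>x. x \<in> ball_tuples N X \<Longrightarrow> norm (\<Phi> x) \<le> C"
  shows "sup_norm N X \<Phi> \<le> C"
  unfolding sup_norm_def ball_tuples_def[symmetric]
  using assms(2) ball_tuples_nonempty[OF X] by (intro cSUP_least) auto

lemma sup_norm_nonneg: "X \<in> banach_tuples N \<Longrightarrow> \<Phi> \<in> U X \<Longrightarrow> 0 \<le> sup_norm N X \<Phi>"
  using ball_tuples_nonempty[of X] sup_norm_upper[of X \<Phi>] order_trans[OF norm_ge_zero] by blast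

lemma sup_norm_le_nU: "X \<in> banach_tuples N \<Longrightarrow> \<Phi> \<in> U X \<Longrightarrow> sup_norm N X \<Phi> \<le> nU X \<Phi>"
  by (rule sup_norm_least) (auto intro: form_bound_ball)

lemma ex_almost_norming:
  assumes X: "X \<in> banach_tuples N" and \<Phi>: "\<Phi> \<in> U X" and \<eta>: "\<eta> > 0"
  shows "\<exists>a\<in>ball_tuples N X. (1 - \<eta>) * sup_norm N X \<Phi> \<le> norm (\<Phi> a)"
proof (rule ccontr)
  assume "\<not> ?thesis"
  then have less: "norm (\<Phi> a) < (1 - \<eta>) * sup_norm N X \<Phi>" if "a \<in> ball_tuples N X" for a
    using that by force
  obtain a where "a \<in> ball_tuples N X" using ball_tuples_nonempty[OF X] by blast
  \<comment> \<open>One point of the ball suffices to make this product positive, which excludes a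
    vanishing supremum norm; only then does \<eta> > 0 give the contradiction.\<close>
  then have "0 < (1 - \<eta>) * sup_norm N X \<Phi>"
    using less[of a] norm_ge_zero[of "\<Phi> a"] by linarith
  moreover have "sup_norm N X \<Phi> \<le> (1 - \<eta>) * sup_norm N X \<Phi>"
    using less by (intro sup_norm_least[OF X]) force
  moreover from calculation have "0 < sup_norm N X \<Phi>"
    using sup_norm_nonneg[OF X \<Phi>] by (cases "sup_norm N X \<Phi> = 0") auto
  with \<eta> have "0 < \<eta> * sup_norm N X \<Phi>" by (rule mult_pos_pos)
  ultimately show False by (simp only: left_diff_distrib mult_1_left)
qed

text \<open>Only coordinate \<open>i\<close> leaves the unit ball, and homogeneity brings it back.
  Divided by the supremum norm, the slices therefore become functionals of norm at most one.\<close>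

lemma slice_bound:
  assumes X: "X \<in> banach_tuples N" and \<Phi>: "\<Phi> \<in> U X" and x: "x \<in> ball_tuples N X"
    and i: "i \<in> {1..N}" and z: "z \<in> carrier (X i)"
  shows "norm (\<Phi> (x(i := z))) \<le> sup_norm N X \<Phi> * nrm (X i) z"
proof -
  interpret normed_space "X i" by (rule normed_component[OF X i])
  note mult = multilinear_smult[OF multilinear[OF X \<Phi>] ball_tuples_tuples[OF x] i]
  show ?thesis
  proof (cases "nrm (X i) z = 0")
    case True
    then have "z = 0 \<odot>\<^bsub>X i\<^esub> z" using z by (simp add: nrm_eq_0_iff)
    then have "\<Phi> (x(i := z)) = 0" using mult[OF z, of 0] by simp
    then show ?thesis using True by simp
  next
    case False
    then have pos: "nrm (X i) z > 0" using nrm_nonneg[OF z] by simp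
    define r :: 'k where "r = of_real (1 / nrm (X i) z)"
    have nr: "norm r = 1 / nrm (X i) z"
      unfolding r_def norm_of_real using pos by simp
    have "r \<odot>\<^bsub>X i\<^esub> z \<in> unit_ball (X i)"
      using z pos by (simp add: unit_ball_def nrm_smult nr)
    from sup_norm_upper[OF X \<Phi> ball_tuples_upd[OF x i this]] show ?thesis
      using pos by (simp add: mult[OF z] norm_mult nr field_simps)
  qed
qed

text \<open>This is \<open>aligned_perturbation\<close> for operators that overwrite one coordinate
  (weight \<epsilon>) or two (weight \<epsilon> * \<beta>) by rank one maps built from slices at
  \<open>a\<close>. At \<open>a\<close> the slices are almost 1 in modulus, which gives the lower
  bound; on the whole ball they are at most 1, which gives the upper bound.\<close>

lemma perturbation_step:
  fixes h :: "nat \<Rightarrow> nat \<Rightarrow> 'k + 'u" and n :: nat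
  defines "P \<equiv> {(c, d) \<in> {1..N} \<times> {1..N}. c \<noteq> d}"
  assumes X: "X \<in> banach_tuples N" and \<Phi>: "\<Phi> \<in> U X" and a: "a \<in> ball_tuples N X"
    and near: "(1 - \<eta>) * sup_norm N X \<Phi> \<le> norm (\<Phi> a)" and \<eta>: "0 \<le> \<eta>"
    and h: "\<And>i. i < n \<Longrightarrow> h i \<in> ball_tuples N X" and "0 \<le> \<epsilon>" "0 \<le> \<beta>"
  shows "\<exists>\<Psi>\<in>U X. nU X (\<lambda>x. \<Psi> x - \<Phi> x) \<le> \<epsilon> * (real (card {1..N}) + \<beta> * real (card (P \<times> {..<n}))) * nU X \<Phi> \<and>
    norm (\<Phi> a) + \<epsilon> * ((\<Sum>c\<in>{1..N}. norm (\<Phi> a) - 2 * \<eta> * sup_norm N X \<Phi>) +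
      \<beta> * (\<Sum>((c, d), i)\<in>P \<times> {..<n}. norm (\<Phi> (a(c := h i c))) - 2 * \<eta> * sup_norm N X \<Phi>)) \<le> norm (\<Psi> a) \<and>
    (\<forall>x\<in>ball_tuples N X. norm (\<Psi> x) \<le> norm (\<Phi> x) + \<epsilon> * ((\<Sum>c\<in>{1..N}. norm (\<Phi> (x(c := a c)))) +
      \<beta> * (\<Sum>((c, d), i)\<in>P \<times> {..<n}. norm (\<Phi> (x(c := h i c, d := a d))))))"
proof -
  define s where "s = sup_norm N X \<Phi>"
  \<comment> \<open>If \<open>s = 0\<close>, division by zero makes \<open>f\<close> vanish, and the
    estimates below stay true.\<close>
  define f where "f c z = \<Phi> (a(c := z)) / of_real s" for c z
  define S where "S c b z = f c z \<odot>\<^bsub>X c\<^esub> b" for c b z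
  define T where "T j i = (case j of Inl c \<Rightarrow> if i = c then S c (a c) else (\<lambda>z. z)
    | Inr ((c, d), m) \<Rightarrow> if i = c then S c (h m c) else if i = d then S d (a d) else (\<lambda>z. z))" for j i
  define w where "w j = (case j of Inl (c :: nat) \<Rightarrow> \<epsilon> | Inr (p :: (nat \<times> nat) \<times> nat) \<Rightarrow> \<epsilon> * \<beta>)" for j
  let ?J = "{1..N} <+> P \<times> {..<n}"
  have "P \<subseteq> {1..N} \<times> {1..N}" by (auto simp: P_def)
  then have "finite P" by (rule finite_subset) simp
  then have fin: "finite ?J" by simp
  have s0: "0 \<le> s" unfolding s_def by (rule sup_norm_nonneg[OF X \<Phi>])
  note at = ball_tuples_tuples[OF a] and ml = multilinear[OF X \<Phi>]
  have fb: "norm (f c z) \<le> nrm (X c) z" if "c \<in> {1..N}" "z \<in> carrier (X c)" for c z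
    using slice_bound[OF X \<Phi> a that] s0 normed_space.nrm_nonneg[OF normed_component[OF X that(1)] that(2)]
    by (cases "s = 0") (simp_all add: f_def s_def[symmetric] norm_divide divide_le_eq mult.commute)
  have f1: "norm (f c (x c)) \<le> 1" if "c \<in> {1..N}" "x \<in> ball_tuples N X" for c x
    using fb[OF that(1), of "x c"] ball_tuplesD[OF that(2,1)] by (simp add: unit_ball_def)
  have Sc: "contraction (X c) (S c b)" if c: "c \<in> {1..N}" and b: "b \<in> unit_ball (X c)" for c b
    unfolding S_def
    by (rule contraction_rank_one[OF normed_component[OF X c] b])
      (use fb[OF c] in \<open>simp_all add: f_def multilinear_add[OF ml at c] multilinear_smult[OF ml at c] add_divide_distrib\<close>)
  have Tc: "contraction (X i) (T j i)" if "j \<in> ?J" and i: "i \<in> {1..N}" for i j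
  proof (cases j)
    case (Inl c)
    then show ?thesis
      using Sc[OF i ball_tuplesD[OF a i]] contraction_id[OF normed_component[OF X i]] by (auto simp: T_def)
  next
    case (Inr p)
    then obtain c d m where "j = Inr ((c, d), m)" and m: "m < n"
      using \<open>j \<in> ?J\<close> by auto
    then show ?thesis
      using Sc[OF i ball_tuplesD[OF a i]] Sc[OF i ball_tuplesD[OF h[OF m] i]]
        contraction_id[OF normed_component[OF X i]] by (auto simp: T_def)
  qed
  have one: "compose_form N X \<Phi> (T (Inl c)) x = f c (x c) * \<Phi> (x(c := a c))"
    if c: "c \<in> {1..N}" and x: "x \<in> ball_tuples N X" for c x
  proof -
    have "(\<lambda>i\<in>{1..N}. T (Inl c) i (x i)) = x(c := f c (x c) \<odot>\<^bsub>X c\<^esub> a c)"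
      using x c by (auto simp: T_def S_def ball_tuples_def PiE_iff extensional_def)
    then show ?thesis
      using multilinear_smult[OF ml ball_tuples_tuples[OF x] c tuplesD[OF at c], of "f c (x c)"]
      by (simp add: compose_form_def ball_tuples_tuples[OF x])
  qed
  have two: "compose_form N X \<Phi> (T (Inr ((c, d), m))) x = f c (x c) * (f d (x d) * \<Phi> (x(c := h m c, d := a d)))"
    if cd: "(c, d) \<in> P" and m: "m < n" and x: "x \<in> ball_tuples N X" for c d m x
  proof -
    have cd: "c \<in> {1..N}" "d \<in> {1..N}" "c \<noteq> d" using cd by (auto simp: P_def)
    have u: "h m c \<in> carrier (X c)" "a d \<in> carrier (X d)" and xt: "x \<in> tuples N X"
      using tuplesD[OF ball_tuples_tuples[OF h[OF m]]] tuplesD[OF at] cd ball_tuples_tuples[OF x] by auto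
    let ?u = "f c (x c) \<odot>\<^bsub>X c\<^esub> h m c"
    have uc: "?u \<in> carrier (X c)"
      by (rule normed_space.smult_closed'[OF normed_component[OF X cd(1)] u(1)])
    have "(\<lambda>i\<in>{1..N}. T (Inr ((c, d), m)) i (x i)) = x(c := ?u, d := f d (x d) \<odot>\<^bsub>X d\<^esub> a d)"
      using x cd by (auto simp: T_def S_def ball_tuples_def PiE_iff extensional_def)
    then have "compose_form N X \<Phi> (T (Inr ((c, d), m))) x = \<Phi> (x(c := ?u, d := f d (x d) \<odot>\<^bsub>X d\<^esub> a d))"
      using xt by (simp add: compose_form_def)
    also have "\<dots> = f d (x d) * \<Phi> (x(d := a d, c := ?u))"
      using multilinear_smult[OF ml tuples_upd[OF xt cd(1) uc] cd(2) u(2)] cd(3) by (simp add: fun_upd_twist)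
    also have "\<Phi> (x(d := a d, c := ?u)) = f c (x c) * \<Phi> (x(d := a d, c := h m c))"
      by (rule multilinear_smult[OF ml tuples_upd[OF xt cd(2) u(2)] cd(1) u(1)])
    finally show ?thesis using cd(3) by (simp add: fun_upd_twist)
  qed
  \<comment> \<open>A slice factor at \<open>a\<close> has modulus at least 1 - \<eta> when
    \<open>s\<close> is nonzero, hence costs at most \<open>\<eta> * s\<close>. The first family
    carries one such factor and the second two; the allowance \<open>2 * \<eta> * s\<close> covers
    both.\<close>
  have low: "r - \<eta> * s \<le> norm (f c (a c)) * r" if "c \<in> {1..N}" "0 \<le> r" "r \<le> s" for c r
  proof (cases "s = 0")
    case True
    then show ?thesis using that by simp
  next
    case False
    then have "norm (f c (a c)) = norm (\<Phi> a) / s" using s0 by (simp add: f_def norm_divide)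
    then have "1 - \<eta> \<le> norm (f c (a c))"
      using near False s0 by (simp add: s_def[symmetric] pos_le_divide_eq)
    then have "(1 - \<eta>) * r \<le> norm (f c (a c)) * r" using that(2) by (rule mult_right_mono)
    moreover have "\<eta> * r \<le> \<eta> * s" using that \<eta> by (intro mult_left_mono)
    ultimately show ?thesis by (simp add: algebra_simps)
  qed
  have w0: "0 \<le> w j" for j
    using \<open>0 \<le> \<epsilon>\<close> \<open>0 \<le> \<beta>\<close> by (cases j) (simp_all add: w_def)
  obtain \<Psi> where \<Psi>: "\<Psi> \<in> U X" "nU X (\<lambda>x. \<Psi> x - \<Phi> x) \<le> (\<Sum>j\<in>?J. w j) * nU X \<Phi>"
    "norm (\<Psi> a) = norm (\<Phi> a) + (\<Sum>j\<in>?J. w j * norm (compose_form N X \<Phi> (T j) a))"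
    "\<And>x. norm (\<Psi> x) \<le> norm (\<Phi> x) + (\<Sum>j\<in>?J. w j * norm (compose_form N X \<Phi> (T j) x))"
    using aligned_perturbation[where T = T and w = w, OF X \<Phi> at fin Tc w0] by blast
  have split: "(\<Sum>j\<in>?J. w j * g j) = \<epsilon> * ((\<Sum>c\<in>{1..N}. g (Inl c)) + \<beta> * (\<Sum>p\<in>P \<times> {..<n}. g (Inr p)))" for g
    using \<open>finite P\<close> by (simp add: sum.Plus w_def sum_distrib_left distrib_left mult.assoc)
  have w: "(\<Sum>j\<in>?J. w j) = \<epsilon> * (real (card {1..N}) + \<beta> * real (card (P \<times> {..<n})))"
    using split[of "\<lambda>_. 1"] by simp
  have A: "(\<Sum>c\<in>{1..N}. norm (\<Phi> a) - 2 * \<eta> * s) \<le> (\<Sum>c\<in>{1..N}. norm (compose_form N X \<Phi> (T (Inl c)) a))"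
  proof (rule sum_mono)
    fix c assume c: "c \<in> {1..N}"
    show "norm (\<Phi> a) - 2 * \<eta> * s \<le> norm (compose_form N X \<Phi> (T (Inl c)) a)"
      using low[OF c, of "norm (\<Phi> a)"] sup_norm_upper[OF X \<Phi> a] mult_nonneg_nonneg[OF \<eta> s0]
      by (simp add: one[OF c a] norm_mult s_def)
  qed
  have "(\<Sum>((c, d), i)\<in>P \<times> {..<n}. norm (\<Phi> (a(c := h i c))) - 2 * \<eta> * s)
    \<le> (\<Sum>p\<in>P \<times> {..<n}. norm (compose_form N X \<Phi> (T (Inr p)) a))"
  proof (rule sum_mono, clarify)
    fix c d m assume cd: "(c, d) \<in> P" and m: "m < n"
    then have c: "c \<in> {1..N}" and d: "d \<in> {1..N}" and "c \<noteq> d" by (auto simp: P_def)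
    let ?r = "norm (\<Phi> (a(c := h m c)))"
    have r: "?r \<le> s"
      unfolding s_def by (rule sup_norm_upper[OF X \<Phi> ball_tuples_upd[OF a c ball_tuplesD[OF h[OF m] c]]])
    have "norm (f d (a d)) * ?r \<le> 1 * s"
      by (rule mult_mono[OF f1[OF d a] r]) simp_all
    from low[OF c _ this[simplified]] low[OF d _ r]
    have "?r - 2 * \<eta> * s \<le> norm (f c (a c)) * (norm (f d (a d)) * ?r)"
      by simp
    \<comment> \<open>At the point \<open>a\<close> itself the second overwrite puts back the
      coordinate already there.\<close>
    moreover have "a(c := h m c, d := a d) = a(c := h m c)"
      using \<open>c \<noteq> d\<close> by auto
    ultimately show "?r - 2 * \<eta> * s \<le> norm (compose_form N X \<Phi> (T (Inr ((c, d), m))) a)"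
      by (simp add: two[OF cd m a] norm_mult)
  qed
  then have B: "\<beta> * (\<Sum>((c, d), i)\<in>P \<times> {..<n}. norm (\<Phi> (a(c := h i c))) - 2 * \<eta> * s)
    \<le> \<beta> * (\<Sum>p\<in>P \<times> {..<n}. norm (compose_form N X \<Phi> (T (Inr p)) a))"
    by (rule mult_left_mono[OF _ \<open>0 \<le> \<beta>\<close>])
  have A': "(\<Sum>c\<in>{1..N}. norm (compose_form N X \<Phi> (T (Inl c)) x)) \<le> (\<Sum>c\<in>{1..N}. norm (\<Phi> (x(c := a c))))"
    if x: "x \<in> ball_tuples N X" for x
    using f1[OF _ x] by (intro sum_mono) (simp add: one x norm_mult mult_left_le_one_le)
  have B': "\<beta> * (\<Sum>p\<in>P \<times> {..<n}. norm (compose_form N X \<Phi> (T (Inr p)) x))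
    \<le> \<beta> * (\<Sum>((c, d), i)\<in>P \<times> {..<n}. norm (\<Phi> (x(c := h i c, d := a d))))" if x: "x \<in> ball_tuples N X" for x
  proof (intro mult_left_mono sum_mono, clarify)
    fix c d m assume cd: "(c, d) \<in> P" and m: "m < n"
    then have c: "c \<in> {1..N}" and d: "d \<in> {1..N}" by (auto simp: P_def)
    let ?r = "norm (\<Phi> (x(c := h m c, d := a d)))"
    have "norm (f c (x c)) * (norm (f d (x d)) * ?r) \<le> norm (f d (x d)) * ?r"
      using f1[OF c x] by (intro mult_left_le_one_le) simp_all
    also have "\<dots> \<le> ?r"
      using f1[OF d x] by (intro mult_left_le_one_le) simp_all
    finally show "norm (compose_form N X \<Phi> (T (Inr ((c, d), m))) x) \<le> ?r"
      by (simp add: two[OF cd m x] norm_mult)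
  qed fact
  show ?thesis
    unfolding s_def[symmetric]
  proof (intro bexI[OF _ \<Psi>(1)] conjI ballI)
    show "nU X (\<lambda>x. \<Psi> x - \<Phi> x) \<le> \<epsilon> * (real (card {1..N}) + \<beta> * real (card (P \<times> {..<n}))) * nU X \<Phi>"
      using \<Psi>(2) unfolding w .
    show "norm (\<Phi> a) + \<epsilon> * ((\<Sum>c\<in>{1..N}. norm (\<Phi> a) - 2 * \<eta> * s) +
        \<beta> * (\<Sum>((c, d), i)\<in>P \<times> {..<n}. norm (\<Phi> (a(c := h i c))) - 2 * \<eta> * s)) \<le> norm (\<Psi> a)"
      unfolding \<Psi>(3) split by (intro add_left_mono mult_left_mono add_mono A B \<open>0 \<le> \<epsilon>\<close>)
    fix x assume x: "x \<in> ball_tuples N X"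
    show "norm (\<Psi> x) \<le> norm (\<Phi> x) + \<epsilon> * ((\<Sum>c\<in>{1..N}. norm (\<Phi> (x(c := a c)))) +
        \<beta> * (\<Sum>((c, d), i)\<in>P \<times> {..<n}. norm (\<Phi> (x(c := h i c, d := a d)))))"
      by (rule order_trans[OF \<Psi>(4)[unfolded split]]) (intro add_left_mono mult_left_mono[OF _ \<open>0 \<le> \<epsilon>\<close>] add_mono A'[OF x] B'[OF x])
  qed
qed

end

subsection \<open>The iteration\<close>

definition index_pairs :: "nat \<Rightarrow> (nat \<times> nat) set" where
  "index_pairs N = {(c, d) \<in> {1..N} \<times> {1..N}. c \<noteq> d}"

lemma finite_index_pairs [simp]: "finite (index_pairs N)"
proof -
  have "index_pairs N \<subseteq> {1..N} \<times> {1..N}" by (auto simp: index_pairs_def)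
  then show ?thesis by (rule finite_subset) simp
qed

lemma mult_quarter_power_le: "real n * (1 / 4) ^ n \<le> (1 / 2) ^ n"
proof -
  have "real n \<le> 2 ^ n" by (rule of_nat_less_two_power[THEN less_imp_le])
  then have "real n * (1 / 4) ^ n \<le> 2 ^ n * (1 / 4) ^ n" by (intro mult_right_mono) auto
  also have "\<dots> = (1 / 2 :: real) ^ n" by (simp add: power_mult_distrib[symmetric])
  finally show ?thesis .
qed

lemma sum_half_powers_le: "(\<Sum>i<n. (1 / 2 :: real) ^ i) \<le> 2"
  by (simp add: sum_gp_strict)

context normed_ideal
begin

lemma norm_form_diff:
  assumes "X \<in> banach_tuples N" "\<Phi> \<in> U X" "\<Psi> \<in> U X" "x \<in> ball_tuples N X"
  shows "norm (\<Phi> x) \<le> norm (\<Psi> x) + nU X (\<lambda>x. \<Phi> x - \<Psi> x)"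
  using norm_triangle_ineq2[of "\<Phi> x" "\<Psi> x"] form_bound_ball[OF assms(1) U_diff[OF assms(1-3)] assms(4)]
  by simp

lemma sup_norm_diff:
  assumes "X \<in> banach_tuples N" "\<Phi> \<in> U X" "\<Psi> \<in> U X"
  shows "sup_norm N X \<Phi> \<le> sup_norm N X \<Psi> + nU X (\<lambda>x. \<Phi> x - \<Psi> x)"
  by (rule sup_norm_least[OF assms(1)])
    (use norm_form_diff[OF assms] sup_norm_upper[OF assms(1,3)] in fastforce)

text \<open>Each perturbation involves all earlier points, not just the last one, so the pairs of
  form and point are obtained by dependent choice along the well-order of the naturals.\<close>

lemma iteration_exists:
  assumes X: "X \<in> banach_tuples N" and \<Phi>0: "\<Phi>0 \<in> U X"
    and "\<And>n. 0 < \<eta> n" "\<And>n. 0 \<le> \<epsilon> n" "\<And>n. 0 \<le> \<beta> n"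
  obtains \<Phi> a where "\<Phi> 0 = \<Phi>0" "\<And>n. \<Phi> n \<in> U X" "\<And>n. a n \<in> ball_tuples N X"
    "\<And>n. (1 - \<eta> n) * sup_norm N X (\<Phi> n) \<le> norm (\<Phi> n (a n))"
    "\<And>n. nU X (\<lambda>x. \<Phi> (Suc n) x - \<Phi> n x) \<le> \<epsilon> n * (real (card {1..N}) + \<beta> n * real (card (index_pairs N \<times> {..<n}))) * nU X (\<Phi> n)"
    "\<And>n. norm (\<Phi> n (a n)) + \<epsilon> n * ((\<Sum>c\<in>{1..N}. norm (\<Phi> n (a n)) - 2 * \<eta> n * sup_norm N X (\<Phi> n)) +
      \<beta> n * (\<Sum>((c, d), i)\<in>index_pairs N \<times> {..<n}. norm (\<Phi> n ((a n)(c := a i c))) - 2 * \<eta> n * sup_norm N X (\<Phi> n)))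
      \<le> norm (\<Phi> (Suc n) (a n))"
    "\<And>n x. x \<in> ball_tuples N X \<Longrightarrow> norm (\<Phi> (Suc n) x) \<le> norm (\<Phi> n x) + \<epsilon> n * ((\<Sum>c\<in>{1..N}. norm (\<Phi> n (x(c := a n c)))) +
      \<beta> n * (\<Sum>((c, d), i)\<in>index_pairs N \<times> {..<n}. norm (\<Phi> n (x(c := a i c, d := a n d)))))"
proof -
  define step where "step n a \<Phi> \<Psi> \<longleftrightarrow>
    nU X (\<lambda>x. \<Psi> x - \<Phi> x) \<le> \<epsilon> n * (real (card {1..N}) + \<beta> n * real (card (index_pairs N \<times> {..<n}))) * nU X \<Phi> \<and>
    norm (\<Phi> (a n)) + \<epsilon> n * ((\<Sum>c\<in>{1..N}. norm (\<Phi> (a n)) - 2 * \<eta> n * sup_norm N X \<Phi>) +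
      \<beta> n * (\<Sum>((c, d), i)\<in>index_pairs N \<times> {..<n}. norm (\<Phi> ((a n)(c := a i c))) - 2 * \<eta> n * sup_norm N X \<Phi>))
      \<le> norm (\<Psi> (a n)) \<and>
    (\<forall>x\<in>ball_tuples N X. norm (\<Psi> x) \<le> norm (\<Phi> x) + \<epsilon> n * ((\<Sum>c\<in>{1..N}. norm (\<Phi> (x(c := a n c)))) +
      \<beta> n * (\<Sum>((c, d), i)\<in>index_pairs N \<times> {..<n}. norm (\<Phi> (x(c := a i c, d := a n d))))))"
    for n and a :: "nat \<Rightarrow> nat \<Rightarrow> 'k + 'u" and \<Phi> \<Psi> :: "(nat \<Rightarrow> 'k + 'u) \<Rightarrow> 'k"
  \<comment> \<open>The pair with index \<open>Suc m\<close> is tied to the form with index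
    \<open>m\<close> and to the points up to \<open>m\<close>. Thus \<open>good g n\<close> depends
    only on \<open>g\<close> below \<open>n\<close>, as the choice principle demands.\<close>
  define good where "good g n p \<longleftrightarrow> fst p \<in> U X \<and> snd p \<in> ball_tuples N X \<and>
      (1 - \<eta> n) * sup_norm N X (fst p) \<le> norm (fst p (snd p)) \<and>
      (case n of 0 \<Rightarrow> fst p = \<Phi>0 | Suc m \<Rightarrow> step m (\<lambda>i. snd (g i)) (fst (g m)) (fst p))"
    for g :: "nat \<Rightarrow> ((nat \<Rightarrow> 'k + 'u) \<Rightarrow> 'k) \<times> (nat \<Rightarrow> 'k + 'u)" and n p
  have "\<exists>g. \<forall>n. good g n (g n)"
  proof (rule dependent_wellorder_choice)
    fix p :: "((nat \<Rightarrow> 'k + 'u) \<Rightarrow> 'k) \<times> (nat \<Rightarrow> 'k + 'u)"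
      and g g' :: "nat \<Rightarrow> ((nat \<Rightarrow> 'k + 'u) \<Rightarrow> 'k) \<times> (nat \<Rightarrow> 'k + 'u)" and n :: nat
    assume eq: "\<And>m. m < n \<Longrightarrow> g m = g' m"
    show "good g n p = good g' n p"
    proof (cases n)
      case (Suc m)
      have s: "(\<Sum>((c, d), i)\<in>index_pairs N \<times> {..<m}. F c d (snd (g i))) =
          (\<Sum>((c, d), i)\<in>index_pairs N \<times> {..<m}. F c d (snd (g' i)))" for F :: "nat \<Rightarrow> nat \<Rightarrow> _ \<Rightarrow> real"
        by (rule sum.cong) (auto simp: eq Suc)
      have "step m (\<lambda>i. snd (g i)) (fst (g m)) (fst p) = step m (\<lambda>i. snd (g' i)) (fst (g m)) (fst p)"
        unfolding step_def
        using eq[of m] s[of "\<lambda>c d y. norm (fst (g m) ((snd (g m))(c := y c))) - 2 * \<eta> m * sup_norm N X (fst (g m))"]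
          s[of "\<lambda>c d y. norm (fst (g m) (_(c := y c, d := snd (g m) d)))"] Suc
        by simp
      then show ?thesis using eq[of m] Suc by (simp add: good_def)
    qed (simp add: good_def)
  next
    fix n and g :: "nat \<Rightarrow> ((nat \<Rightarrow> 'k + 'u) \<Rightarrow> 'k) \<times> (nat \<Rightarrow> 'k + 'u)"
    assume IH: "\<And>m. m < n \<Longrightarrow> good g m (g m)"
    have "\<exists>\<Psi>\<in>U X. case n of 0 \<Rightarrow> \<Psi> = \<Phi>0 | Suc m \<Rightarrow> step m (\<lambda>i. snd (g i)) (fst (g m)) \<Psi>"
    proof (cases n)
      case 0
      then show ?thesis using \<Phi>0 by simp
    next
      case (Suc m)
      then have m: "good g m (g m)" and h: "\<And>i. i < m \<Longrightarrow> snd (g i) \<in> ball_tuples N X"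
        using IH by (auto simp: good_def)
      have "\<exists>\<Psi>\<in>U X. step m (\<lambda>i. snd (g i)) (fst (g m)) \<Psi>"
        unfolding step_def index_pairs_def
        by (rule perturbation_step[OF X _ _ _ less_imp_le[OF assms(3)] h assms(4,5)])
          (use m in \<open>simp_all add: good_def\<close>)
      then show ?thesis using Suc by simp
    qed
    then obtain \<Psi> where "\<Psi> \<in> U X" "case n of 0 \<Rightarrow> \<Psi> = \<Phi>0 | Suc m \<Rightarrow> step m (\<lambda>i. snd (g i)) (fst (g m)) \<Psi>"
      by blast
    moreover obtain b where "b \<in> ball_tuples N X" "(1 - \<eta> n) * sup_norm N X \<Psi> \<le> norm (\<Psi> b)"
      using ex_almost_norming[OF X \<open>\<Psi> \<in> U X\<close> assms(3)[of n]] by blast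
    ultimately have "good g n (\<Psi>, b)" by (cases n) (simp_all add: good_def)
    then show "\<exists>p. good g n p" ..
  qed
  then obtain g where g: "\<And>n. good g n (g n)" by blast
  have step: "step n (\<lambda>i. snd (g i)) (fst (g n)) (fst (g (Suc n)))" for n
    using g[of "Suc n"] by (simp add: good_def)
  show thesis
  proof (rule that[of "\<lambda>n. fst (g n)" "\<lambda>n. snd (g n)"])
    show "fst (g 0) = \<Phi>0" using g[of 0] by (simp add: good_def)
  qed (use g step in \<open>auto simp: good_def step_def\<close>)
qed

end

section \<open>Completeness and the limit of the iteration\<close>

context banach_ideal
begin

text \<open>The limit inherits the explicit rate: comparing with a far member of the sequence bounds
  its distance to \<open>F m\<close> by \<open>\<tau> m + e\<close> for every e > 0.\<close>

lemma U_complete: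
  assumes X: "X \<in> banach_tuples N" and F: "\<And>n. F n \<in> U X"
    and cauchy: "\<And>m n. m \<le> n \<Longrightarrow> nU X (\<lambda>x. F n x - F m x) \<le> \<tau> m" and "\<tau> \<longlonglongrightarrow> 0"
  shows "\<exists>\<Phi>\<in>U X. \<forall>m. nU X (\<lambda>x. \<Phi> x - F m x) \<le> \<tau> m"
proof -
  let ?V = "fun_space (U X) (nU X)"
  interpret V: banach_space ?V by (rule banach[OF X])
  have dist: "ndist ?V f g = nU X (\<lambda>x. f x - g x)" if "f \<in> U X" "g \<in> U X" for f g
    using that by (simp add: V.ndist_smult)
  have "V.metric.MCauchy F"
    unfolding V.metric.MCauchy_def
  proof (intro conjI allI impI)
    show "range F \<subseteq> carrier ?V" using F by auto
    fix e :: real assume "e > 0"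
    then have "\<forall>\<^sub>F n in sequentially. \<tau> n < e / 2"
      using \<open>\<tau> \<longlonglongrightarrow> 0\<close> by (intro order_tendstoD(2)[of \<tau> 0]) auto
    then obtain M where M: "\<tau> M < e / 2" by (auto simp: eventually_sequentially)
    have "ndist ?V (F n) (F n') < e" if "M \<le> n" "M \<le> n'" for n n'
      using cauchy[OF that(1)] cauchy[OF that(2)] M nU_diff_triangle[OF X F[of n] F[of M] F[of n']]
        nU_diff_commute[OF X F[of M] F[of n']] by (simp add: dist F)
    then show "\<exists>M. \<forall>n n'. M \<le> n \<longrightarrow> M \<le> n' \<longrightarrow> ndist ?V (F n) (F n') < e" by blast
  qed
  then obtain \<Phi> where lim: "limitin V.metric.mtopology F \<Phi> sequentially"
    using V.complete unfolding V.metric.mcomplete_def by blast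
  then have \<Phi>: "\<Phi> \<in> U X"
    and close: "\<And>e. e > 0 \<Longrightarrow> \<forall>\<^sub>F n in sequentially. nU X (\<lambda>x. F n x - \<Phi> x) < e"
    unfolding V.metric.limitin_metric by (auto simp: dist F)
  have "nU X (\<lambda>x. \<Phi> x - F m x) \<le> \<tau> m + e" if e: "e > 0" for m e
  proof -
    have "\<forall>\<^sub>F n in sequentially. nU X (\<lambda>x. F n x - \<Phi> x) < e \<and> m \<le> n"
      using close[OF e] eventually_ge_at_top[of m] by eventually_elim auto
    then obtain n where n: "nU X (\<lambda>x. F n x - \<Phi> x) < e" "m \<le> n"
      by (auto simp: eventually_sequentially)
    then show ?thesis
      using cauchy[OF n(2)] nU_diff_triangle[OF X \<Phi> F[of n] F[of m]] nU_diff_commute[OF X \<Phi> F[of n]] by simp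
  qed
  then have "nU X (\<lambda>x. \<Phi> x - F m x) \<le> \<tau> m" for m
    by (rule field_le_epsilon)
  then show ?thesis using \<Phi> by blast
qed

text \<open>One inequality, \<open>main\<close>, is used twice. Its right side carries the small
  factor \<open>\<beta> n\<close>, so the one-coordinate defects \<open>Q\<close> are summable,
  which bounds \<open>D\<close> uniformly; dividing it by \<open>\<beta> n\<close> then bounds the
  two-coordinate defects \<open>R\<close>.\<close>

lemma ex_close_form_with_summable_defects:
  assumes X: "X \<in> banach_tuples N" and \<Phi>0: "\<Phi>0 \<in> U X" and \<delta>: "\<delta> > 0"
  obtains \<Phi> and a :: "nat \<Rightarrow> nat \<Rightarrow> _" and C where "\<Phi> \<in> U X" "nU X (\<lambda>x. \<Phi> x - \<Phi>0 x) \<le> \<delta>" "\<And>n. a n \<in> ball_tuples N X"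
    "\<And>c d m n k. (c, d) \<in> index_pairs N \<Longrightarrow> m \<le> n \<Longrightarrow> n < k \<Longrightarrow>
      (\<Sum>i<m. sup_norm N X \<Phi> - norm (\<Phi> ((a k)(c := a i c, d := a n d)))) \<le> C"
proof -
  let ?P = "index_pairs N"
  define M where "M = nU X \<Phi>0 + 1"
  define K where "K = 1 + real N + real (card ?P)"
  have M: "M \<ge> 1" using nU_nonneg[OF X \<Phi>0] by (simp add: M_def)
  have K: "K \<ge> 1" "real N \<le> K" "real (card ?P) \<le> K" "real N + real (card ?P) \<le> K" by (simp_all add: K_def)
  \<comment> \<open>The quadratic exponent makes \<open>\<tau> (Suc n) / \<tau> n\<close> equal to
    \<open>\<beta> n / 4\<close>: errors made after step \<open>n\<close>, even divided by
    \<open>\<epsilon> n\<close>, are of order \<open>\<beta> n\<close>. The factor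
    \<open>min 1 \<delta>\<close> keeps the total change below both \<delta> and 1.\<close>
  define \<tau> where "\<tau> n = min 1 \<delta> * (1 / 2) ^ (n * n + n)" for n :: nat
  \<comment> \<open>Small enough for \<open>real n * \<beta> n\<close> to be summable, since the
    second family has a number of members proportional to \<open>n\<close>.\<close>
  define \<beta> where "\<beta> n = (1 / 4 :: real) ^ n" for n :: nat
  \<comment> \<open>With this choice step \<open>n\<close> changes the form by at most
    \<open>\<tau> n / 2\<close>, hence by at most \<open>\<tau> n - \<tau> (Suc n)\<close>.\<close>
  define \<epsilon> where "\<epsilon> n = \<tau> n / (2 * K * M)" for n
  \<comment> \<open>As \<open>M\<close> will bound all supremum norms, \<open>a n\<close> misses the
    norm of its form by at most \<open>\<tau> (Suc n)\<close>.\<close>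
  define \<eta> where "\<eta> n = \<tau> (Suc n) / M" for n
  have \<tau>_pos: "0 < \<tau> n" for n using \<delta> by (simp add: \<tau>_def)
  have \<beta>_pos: "0 < \<beta> n" and \<beta>_le: "\<beta> n \<le> 1" for n by (simp_all add: \<beta>_def power_le_one)
  have \<tau>_Suc: "\<tau> (Suc n) = \<tau> n * \<beta> n / 4" for n
  proof -
    have "Suc n * Suc n + Suc n = (n * n + n) + (2 * n + 2)" by (simp add: algebra_simps)
    then have "\<tau> (Suc n) = \<tau> n * (1 / 2) ^ (2 * n + 2)" unfolding \<tau>_def by (simp only: power_add mult.assoc)
    also have "(1 / 2 :: real) ^ (2 * n + 2) = \<beta> n / 4" by (simp add: \<beta>_def power_add power_mult power2_eq_square)
    finally show ?thesis by simp
  qed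
  have \<tau>_half: "\<tau> (Suc n) \<le> \<tau> n / 2" for n
    using mult_left_mono[OF \<beta>_le[of n], of "\<tau> n"] \<tau>_pos[of n] by (simp add: \<tau>_Suc)
  have \<tau>_anti: "\<tau> n \<le> \<tau> m" if "m \<le> n" for m n
    using that
  proof (rule lift_Suc_antimono_le[rotated])
    show "\<tau> (Suc n) \<le> \<tau> n" for n using \<tau>_half[of n] \<tau>_pos[of n] by simp
  qed
  have \<tau>_le: "\<tau> n \<le> (1 / 2) ^ n" for n
  proof -
    have "\<tau> n \<le> 1 * (1 / 2) ^ (n * n + n)" unfolding \<tau>_def by (intro mult_right_mono) auto
    also have "\<dots> \<le> (1 / 2) ^ n" by (simp add: power_decreasing)
    finally show ?thesis .
  qed
  have \<tau>_lim: "\<tau> \<longlonglongrightarrow> 0"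
    by (rule tendsto_sandwich[OF _ _ tendsto_const LIMSEQ_realpow_zero[of "1 / 2"]])
      (use \<tau>_pos \<tau>_le in \<open>auto simp: less_imp_le\<close>)
  have \<epsilon>_pos: "0 < \<epsilon> n" for n using \<tau>_pos[of n] K M by (simp add: \<epsilon>_def)
  have \<eta>_pos: "0 < \<eta> n" for n using \<tau>_pos[of "Suc n"] M by (simp add: \<eta>_def)
  show thesis
  proof (rule iteration_exists[where \<eta> = \<eta> and \<epsilon> = \<epsilon> and \<beta> = \<beta>,
      OF X \<Phi>0 \<eta>_pos less_imp_le[OF \<epsilon>_pos] less_imp_le[OF \<beta>_pos]])
    fix \<Phi> a assume \<Phi>_0: "\<Phi> 0 = \<Phi>0" and \<Phi>: "\<And>n. \<Phi> n \<in> U X" and a: "\<And>n. a n \<in> ball_tuples N X"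
    and near: "\<And>n. (1 - \<eta> n) * sup_norm N X (\<Phi> n) \<le> norm (\<Phi> n (a n))"
    and incr: "\<And>n. nU X (\<lambda>x. \<Phi> (Suc n) x - \<Phi> n x) \<le> \<epsilon> n * (real (card {1..N}) + \<beta> n * real (card (?P \<times> {..<n}))) * nU X (\<Phi> n)"
    and lower: "\<And>n. norm (\<Phi> n (a n)) + \<epsilon> n * ((\<Sum>c\<in>{1..N}. norm (\<Phi> n (a n)) - 2 * \<eta> n * sup_norm N X (\<Phi> n)) +
      \<beta> n * (\<Sum>((c, d), i)\<in>?P \<times> {..<n}. norm (\<Phi> n ((a n)(c := a i c))) - 2 * \<eta> n * sup_norm N X (\<Phi> n)))
      \<le> norm (\<Phi> (Suc n) (a n))"
    and upper: "\<And>n x. x \<in> ball_tuples N X \<Longrightarrow> norm (\<Phi> (Suc n) x) \<le> norm (\<Phi> n x) + \<epsilon> n * ((\<Sum>c\<in>{1..N}. norm (\<Phi> n (x(c := a n c)))) +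
      \<beta> n * (\<Sum>((c, d), i)\<in>?P \<times> {..<n}. norm (\<Phi> n (x(c := a i c, d := a n d)))))"
    define s where "s n = sup_norm N X (\<Phi> n)" for n
    have n\<beta>: "real n * \<beta> n \<le> 1" for n
      using mult_quarter_power_le[of n] power_le_one[of "1 / 2 :: real" n] by (simp add: \<beta>_def)
    \<comment> \<open>The telescoped bound presupposes that \<open>M\<close> bounds the earlier
      ideal norms. That bound is proved next by strong induction, which uses this estimate at each
      stage.\<close>
    have cauchy': "nU X (\<lambda>x. \<Phi> n x - \<Phi> m x) \<le> \<tau> m - \<tau> n" if "m \<le> n" "\<And>l. l < n \<Longrightarrow> nU X (\<Phi> l) \<le> M" for m n
      using that
    proof (induction rule: dec_induct)
      case base
      then show ?case using nU_smult[OF X \<Phi>, of 0] by simp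
    next
      case (step n)
      have "\<epsilon> n * (real (card {1..N}) + \<beta> n * real (card (?P \<times> {..<n}))) * nU X (\<Phi> n) \<le> \<epsilon> n * K * M"
      proof (intro mult_mono mult_left_mono)
        have "\<beta> n * real (card (?P \<times> {..<n})) = real (card ?P) * (real n * \<beta> n)" by (simp add: card_cartesian_product)
        also have "\<dots> \<le> real (card ?P) * 1" by (intro mult_left_mono n\<beta>) auto
        finally show "real (card {1..N}) + \<beta> n * real (card (?P \<times> {..<n})) \<le> K" by (simp add: K_def)
      qed (use \<epsilon>_pos[of n] \<beta>_pos[of n] K M step nU_nonneg[OF X \<Phi>] in \<open>auto intro!: mult_nonneg_nonneg simp: less_imp_le\<close>)
      also have "\<dots> = \<tau> n / 2" using K M by (simp add: \<epsilon>_def)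
      also have "\<dots> \<le> \<tau> n - \<tau> (Suc n)" using \<tau>_half[of n] by simp
      finally have "nU X (\<lambda>x. \<Phi> (Suc n) x - \<Phi> n x) \<le> \<tau> n - \<tau> (Suc n)" using incr[of n] by simp
      then show ?case using step nU_diff_triangle[OF X \<Phi>[of "Suc n"] \<Phi>[of n] \<Phi>[of m]] by simp
    qed
    have nU_M: "nU X (\<Phi> n) \<le> M" for n
    proof (induction n rule: less_induct)
      case (less n)
      \<comment> \<open>Since \<open>\<tau> 0 \<le> 1\<close>, the total drift fits into the 1 by
        which \<open>M\<close> exceeds \<open>nU X \<Phi>0\<close>.\<close>
      have "nU X (\<lambda>x. \<Phi> n x - \<Phi> 0 x) \<le> \<tau> 0 - \<tau> n" by (rule cauchy') (use less in auto)
      then have "nU X (\<lambda>x. \<Phi> n x - \<Phi> 0 x) \<le> 1" using \<tau>_le[of 0] \<tau>_pos[of n] by simp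
      then show ?case
        using nU_triangle[OF X U_diff[OF X \<Phi>[of n] \<Phi>[of 0]] \<Phi>[of 0]] by (simp add: M_def \<Phi>_0)
    qed
    have cauchy: "nU X (\<lambda>x. \<Phi> n x - \<Phi> m x) \<le> \<tau> m" if "m \<le> n" for m n
      using cauchy'[OF that nU_M] \<tau>_pos[of n] by simp
    have cauchy2: "nU X (\<lambda>x. \<Phi> m x - \<Phi> n x) \<le> \<tau> m" if "m \<le> n" for m n
      using cauchy[OF that] nU_diff_commute[OF X \<Phi>[of m] \<Phi>[of n]] by simp
    have s_M: "s n \<le> M" and s_nonneg: "0 \<le> s n" for n
      using sup_norm_le_nU[OF X \<Phi>[of n]] nU_M[of n] sup_norm_nonneg[OF X \<Phi>[of n]] by (simp_all add: s_def)
    have s_ge: "norm (\<Phi> n x) \<le> s n" if "x \<in> ball_tuples N X" for n x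
      unfolding s_def by (rule sup_norm_upper[OF X \<Phi> that])
    have upd: "x(c := a i c) \<in> ball_tuples N X" if "x \<in> ball_tuples N X" "c \<in> {1..N}" for x c i
      using that ball_tuples_upd[OF that] ball_tuplesD[OF a] by blast
    have P: "c \<in> {1..N}" "d \<in> {1..N}" if "(c, d) \<in> ?P" for c d
      using that by (auto simp: index_pairs_def)
    \<comment> \<open>\<open>Q\<close> and \<open>R\<close> collect the defects at \<open>x\<close>
      of the one- and two-coordinate replacements in step \<open>n\<close>. \<open>D n\<close> is
      \<open>R n (a n)\<close>, because replacing coordinate \<open>d\<close> by
      \<open>a n d\<close> changes nothing there.\<close>
    define Q where "Q n x = (\<Sum>c\<in>{1..N}. s n - norm (\<Phi> n (x(c := a n c))))" for n x
    define R where "R n x = (\<Sum>((c, d), i)\<in>?P \<times> {..<n}. s n - norm (\<Phi> n (x(c := a i c, d := a n d))))" for n x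
    define D where "D n = (\<Sum>((c, d), i)\<in>?P \<times> {..<n}. s n - norm (\<Phi> n ((a n)(c := a i c))))" for n
    have R_nonneg: "0 \<le> R n (a k)" for n k
      unfolding R_def using P by (intro sum_nonneg) (auto intro!: s_ge upd a)
    define C0 where "C0 = 2 * K * M + K"
    \<comment> \<open>The form with index \<open>Suc n\<close> is compared at two points. The lower
      bound of the step holds at \<open>a n\<close> and the upper bound at \<open>a k\<close>, and
      \<open>a k\<close> almost norms this form. Hence the weighted defects at \<open>a k\<close>
      exceed those at \<open>a n\<close> only by errors that are multiples of
      \<open>\<tau> (Suc n)\<close>.\<close>
    have main: "Q n (a k) + \<beta> n * R n (a k) \<le> \<beta> n * (C0 + D n)" if "n < k" for n k
    proof -
      define T where "T = \<tau> (Suc n)"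
      define cP where "cP = real (card (?P \<times> {..<n}))"
      have T_pos: "0 < T" unfolding T_def by (rule \<tau>_pos)
      have \<eta>s: "\<eta> l * s l \<le> \<tau> (Suc l)" for l
        using mult_left_mono[OF s_M[of l] less_imp_le[OF \<eta>_pos[of l]]] M by (simp add: \<eta>_def)
      have cP: "\<beta> n * cP \<le> real (card ?P)"
        using mult_left_mono[OF n\<beta>[of n], of "real (card ?P)"] by (simp add: cP_def card_cartesian_product mult_ac)
      have k: "Suc n \<le> k" using that by simp
      \<comment> \<open>Three errors of size \<open>T\<close> arise: \<open>a k\<close> norms its
        own form only approximately, that form is replaced by the one with index
        \<open>Suc n\<close>, and the two supremum norms are compared.\<close>
      have "s k - T \<le> norm (\<Phi> k (a k))"
        using near[of k] \<eta>s[of k] \<tau>_anti[of "Suc n" "Suc k"] k by (simp add: s_def T_def left_diff_distrib)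
      moreover have "norm (\<Phi> k (a k)) \<le> norm (\<Phi> (Suc n) (a k)) + T"
        using norm_form_diff[OF X \<Phi>[of k] \<Phi>[of "Suc n"] a[of k]] cauchy[OF k] by (simp add: T_def)
      moreover have "s (Suc n) \<le> s k + T"
        using sup_norm_diff[OF X \<Phi>[of "Suc n"] \<Phi>[of k]] cauchy2[OF k] by (simp add: T_def s_def)
      ultimately have low: "norm (\<Phi> (Suc n) (a n)) - 3 * T \<le> norm (\<Phi> (Suc n) (a k))"
        using s_ge[OF a, of "Suc n" n] by linarith
      have "norm (\<Phi> (Suc n) (a k)) \<le> norm (\<Phi> n (a k)) + \<epsilon> n * ((real N * s n - Q n (a k)) + \<beta> n * (cP * s n - R n (a k)))"
        using upper[OF a, of n k] by (simp add: Q_def R_def cP_def sum_subtractf split_def)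
      then have up: "norm (\<Phi> (Suc n) (a k)) \<le> s n + \<epsilon> n * ((real N * s n - Q n (a k)) + \<beta> n * (cP * s n - R n (a k)))"
        using s_ge[OF a, of n k] by linarith
      have p: "s n - T \<le> norm (\<Phi> n (a n))"
        using near[of n] \<eta>s[of n] by (simp add: s_def T_def left_diff_distrib)
      have "norm (\<Phi> n (a n)) + \<epsilon> n * (real N * (norm (\<Phi> n (a n)) - 2 * \<eta> n * s n) + \<beta> n * (cP * (s n - 2 * \<eta> n * s n) - D n))
          \<le> norm (\<Phi> (Suc n) (a n))"
        using lower[of n] by (simp add: D_def cP_def sum_subtractf split_def s_def[symmetric] algebra_simps)
      moreover have "real N * (s n - 3 * T) \<le> real N * (norm (\<Phi> n (a n)) - 2 * \<eta> n * s n)"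
        using p \<eta>s[of n] by (intro mult_left_mono) (simp_all add: T_def)
      moreover have "\<beta> n * (cP * s n - D n) - real (card ?P) * (2 * T) \<le> \<beta> n * (cP * (s n - 2 * \<eta> n * s n) - D n)"
      proof -
        have "(\<beta> n * cP) * (2 * (\<eta> n * s n)) \<le> real (card ?P) * (2 * T)"
          using \<eta>s[of n] cP less_imp_le[OF \<eta>_pos[of n]] s_nonneg[of n] by (intro mult_mono) (simp_all add: T_def)
        then show ?thesis by (simp add: algebra_simps)
      qed
      ultimately have "norm (\<Phi> n (a n)) + \<epsilon> n * (real N * (s n - 3 * T) + (\<beta> n * (cP * s n - D n) - real (card ?P) * (2 * T)))
          \<le> norm (\<Phi> (Suc n) (a n))"
        using mult_left_mono[of "real N * (s n - 3 * T) + (\<beta> n * (cP * s n - D n) - real (card ?P) * (2 * T))"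
          "real N * (norm (\<Phi> n (a n)) - 2 * \<eta> n * s n) + \<beta> n * (cP * (s n - 2 * \<eta> n * s n) - D n)" "\<epsilon> n"] \<epsilon>_pos[of n]
        by linarith
      then have "\<epsilon> n * (Q n (a k) + \<beta> n * R n (a k)) \<le> 4 * T + \<epsilon> n * ((3 * real N + 2 * real (card ?P)) * T + \<beta> n * D n)"
        using p low up by (simp add: algebra_simps)
      \<comment> \<open>Three of the four \<open>T\<close> come from \<open>low\<close> and one from
        \<open>p\<close>. The ratio of consecutive values of \<tau> supplies the factor
        \<open>\<beta> n\<close>.\<close>
      also have "4 * T = \<epsilon> n * (2 * K * M * \<beta> n)"
        using K M by (simp add: T_def \<tau>_Suc \<epsilon>_def)
      finally have "\<epsilon> n * (Q n (a k) + \<beta> n * R n (a k)) \<le> \<epsilon> n * (2 * K * M * \<beta> n + ((3 * real N + 2 * real (card ?P)) * T + \<beta> n * D n))"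
        by (simp add: distrib_left)
      then have "Q n (a k) + \<beta> n * R n (a k) \<le> 2 * K * M * \<beta> n + ((3 * real N + 2 * real (card ?P)) * T + \<beta> n * D n)"
        using \<epsilon>_pos[of n] by (simp only: mult_le_cancel_left_pos)
      moreover have "(3 * real N + 2 * real (card ?P)) * T \<le> (3 * K) * (\<beta> n / 4)"
      proof (rule mult_mono)
        show "T \<le> \<beta> n / 4"
          using mult_right_mono[of "\<tau> n" 1 "\<beta> n"] \<tau>_le[of n] power_le_one[of "1 / 2 :: real" n] \<beta>_pos[of n]
          by (simp add: T_def \<tau>_Suc)
      qed (use T_pos K in \<open>simp_all add: K_def\<close>)
      moreover have "3 * K * (\<beta> n / 4) \<le> K * \<beta> n" using K \<beta>_pos[of n] by simp
      ultimately show ?thesis by (simp add: C0_def algebra_simps)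
    qed
    \<comment> \<open>A bound linear in \<open>n\<close> is enough at first: multiplied by
      \<open>\<beta> n\<close> it is still summable, which gives \<open>Q_le\<close>.\<close>
    have D_crude: "D n \<le> K * real n * M" for n
    proof -
      have "D n \<le> (\<Sum>p\<in>?P \<times> {..<n}. M)"
        unfolding D_def using s_M[of n] by (intro sum_mono) (auto intro: order_trans[OF diff_right_mono])
      also have "\<dots> = real (card ?P) * real n * M" by (simp add: card_cartesian_product)
      also have "\<dots> \<le> K * real n * M" using K M by (intro mult_right_mono) auto
      finally show ?thesis .
    qed
    have KM: "0 \<le> K * M" and C0: "0 \<le> C0" using K M by (simp_all add: C0_def)
    have Q_le: "Q n (a k) \<le> (1 / 2) ^ n * (C0 + K * M)" if "n < k" for n k
    proof -
      have "Q n (a k) \<le> \<beta> n * (C0 + D n)"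
        using main[OF that] mult_nonneg_nonneg[OF less_imp_le[OF \<beta>_pos] R_nonneg, of n n k] by linarith
      also have "\<dots> \<le> \<beta> n * (C0 + K * real n * M)"
        using D_crude[of n] \<beta>_pos[of n] by (intro mult_left_mono) auto
      also have "\<dots> = \<beta> n * C0 + (real n * \<beta> n) * (K * M)" by (simp add: algebra_simps)
      also have "\<dots> \<le> (1 / 2) ^ n * C0 + (1 / 2) ^ n * (K * M)"
        using mult_quarter_power_le[of n] KM C0
        by (intro add_mono mult_right_mono) (auto simp: \<beta>_def intro: power_mono)
      finally show ?thesis by (simp add: distrib_left)
    qed
    define C1 where "C1 = 2 * K * (C0 + K * M + 2)"
    \<comment> \<open>The terms of \<open>D n\<close> with index \<open>i\<close> are, up to
      \<open>2 * \<tau> i\<close>, defects that \<open>Q i (a n)\<close> already contains. The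
      geometric decay of \<open>Q\<close> in \<open>i\<close> makes their sum bounded independently
      of \<open>n\<close>.\<close>
    have D_le: "D n \<le> C1" for n
    proof -
      let ?c = "C0 + K * M + 2"
      have "D n \<le> (\<Sum>(p, i)\<in>?P \<times> {..<n}. (1 / 2) ^ i * ?c)"
        unfolding D_def
      proof (rule sum_mono, clarify)
        fix c d i assume cd: "(c, d) \<in> ?P" and i: "i < n"
        note c = P(1)[OF cd]
        let ?x = "(a n)(c := a i c)"
        have "s i - norm (\<Phi> i ?x) \<le> Q i (a n)"
          unfolding Q_def by (rule member_le_sum[OF c]) (auto intro!: s_ge upd a)
        moreover have "s n \<le> s i + \<tau> i"
          using sup_norm_diff[OF X \<Phi>[of n] \<Phi>[of i]] cauchy[of i n] i by (simp add: s_def)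
        moreover have "norm (\<Phi> i ?x) \<le> norm (\<Phi> n ?x) + \<tau> i"
          using norm_form_diff[OF X \<Phi>[of i] \<Phi>[of n] upd[OF a[of n] c, of i]] cauchy2[of i n] i by simp
        ultimately have "s n - norm (\<Phi> n ?x) \<le> (1 / 2) ^ i * (C0 + K * M) + 2 * (1 / 2) ^ i"
          using Q_le[OF i] \<tau>_le[of i] by linarith
        then show "s n - norm (\<Phi> n ?x) \<le> (1 / 2) ^ i * ?c" by (simp add: algebra_simps)
      qed
      also have "\<dots> = real (card ?P) * ((\<Sum>i<n. (1 / 2) ^ i) * ?c)"
        by (simp add: sum.cartesian_product[symmetric] sum_distrib_right)
      also have "\<dots> \<le> K * (2 * ?c)"
        using K KM C0 sum_half_powers_le[of n] by (intro mult_mono) (auto intro!: sum_nonneg mult_nonneg_nonneg)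
      finally show ?thesis by (simp add: C1_def mult_ac)
    qed
    \<comment> \<open>The nonnegative \<open>Q\<close> is dropped from \<open>main\<close> and the
      common factor \<open>\<beta> n\<close> cancelled.\<close>
    have R_le: "R n (a k) \<le> C0 + C1" if "n < k" for n k
    proof -
      have "0 \<le> Q n (a k)"
        unfolding Q_def by (intro sum_nonneg) (auto intro!: s_ge upd a)
      then have "\<beta> n * R n (a k) \<le> \<beta> n * (C0 + D n)" using main[OF that] by linarith
      then have "R n (a k) \<le> C0 + D n" using \<beta>_pos[of n] by (simp only: mult_le_cancel_left_pos)
      then show ?thesis using D_le[of n] by simp
    qed
    obtain \<Psi> where \<Psi>: "\<Psi> \<in> U X" "\<And>m. nU X (\<lambda>x. \<Psi> x - \<Phi> m x) \<le> \<tau> m"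
      using U_complete[OF X \<Phi> cauchy \<tau>_lim] by blast
    have \<Psi>': "nU X (\<lambda>x. \<Phi> m x - \<Psi> x) \<le> \<tau> m" for m
      using \<Psi>(2)[of m] nU_diff_commute[OF X \<Phi>[of m] \<Psi>(1)] by simp
    \<comment> \<open>Defects are nonnegative, so the sum may be extended to \<open>i < n\<close>.
      Passing from the form with index \<open>n\<close> to the limit costs
      \<open>2 * \<tau> n\<close> per term, at most 2 altogether.\<close>
    have fin: "(\<Sum>i<m. sup_norm N X \<Psi> - norm (\<Psi> ((a k)(c := a i c, d := a n d)))) \<le> C0 + C1 + 2"
      if cd: "(c, d) \<in> ?P" and "m \<le> n" "n < k" for c d m n k
    proof -
      let ?x = "\<lambda>i. (a k)(c := a i c, d := a n d)"
      have x: "?x i \<in> ball_tuples N X" for i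
        by (intro upd a P[OF cd])
      have "(\<Sum>i<m. sup_norm N X \<Psi> - norm (\<Psi> (?x i))) \<le> (\<Sum>i<n. sup_norm N X \<Psi> - norm (\<Psi> (?x i)))"
        using \<open>m \<le> n\<close> sup_norm_upper[OF X \<Psi>(1) x] by (intro sum_mono2) auto
      also have "\<dots> \<le> (\<Sum>i<n. (s n - norm (\<Phi> n (?x i))) + 2 * \<tau> n)"
      proof (rule sum_mono)
        fix i
        show "sup_norm N X \<Psi> - norm (\<Psi> (?x i)) \<le> (s n - norm (\<Phi> n (?x i))) + 2 * \<tau> n"
          using sup_norm_diff[OF X \<Psi>(1) \<Phi>[of n]] norm_form_diff[OF X \<Phi>[of n] \<Psi>(1) x[of i]] \<Psi>(2)[of n] \<Psi>'[of n]
          by (simp add: s_def)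
      qed
      also have "\<dots> = (\<Sum>i<n. s n - norm (\<Phi> n (?x i))) + 2 * (real n * \<tau> n)"
        by (simp add: sum.distrib)
      \<comment> \<open>The defects of the other index pairs are nonnegative, so a single pair is
        dominated by the full sum \<open>R\<close>.\<close>
      also have "(\<Sum>i<n. s n - norm (\<Phi> n (?x i))) \<le> (\<Sum>(c, d)\<in>?P. \<Sum>i<n. s n - norm (\<Phi> n ((a k)(c := a i c, d := a n d))))"
      proof -
        have "0 \<le> (\<Sum>i<n. s n - norm (\<Phi> n ((a k)(c' := a i c', d' := a n d'))))" if "(c', d') \<in> ?P" for c' d'
          using P[OF that] by (intro sum_nonneg) (auto intro!: s_ge upd a)
        then have "(case (c, d) of (c, d) \<Rightarrow> \<Sum>i<n. s n - norm (\<Phi> n ((a k)(c := a i c, d := a n d))))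
            \<le> (\<Sum>(c, d)\<in>?P. \<Sum>i<n. s n - norm (\<Phi> n ((a k)(c := a i c, d := a n d))))"
          by (intro member_le_sum[OF cd]) auto
        then show ?thesis by simp
      qed
      also have "\<dots> = R n (a k)"
        unfolding R_def by (simp add: sum.cartesian_product split_def)
      also have "R n (a k) \<le> C0 + C1" by (rule R_le[OF \<open>n < k\<close>])
      also have "real n * \<tau> n \<le> 1"
      proof -
        have "real n * \<tau> n \<le> 2 ^ n * (1 / 2) ^ n"
          using \<tau>_le[of n] \<tau>_pos[of n] of_nat_less_two_power[of n, where ?'a = real] by (intro mult_mono) auto
        then show ?thesis by (simp add: power_mult_distrib[symmetric])
      qed
      finally show ?thesis by (simp add: fun_upd_def)
    qed
    have "nU X (\<lambda>x. \<Psi> x - \<Phi>0 x) \<le> \<delta>"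
      using \<Psi>(2)[of 0] \<Phi>_0 by (simp add: \<tau>_def)
    from \<Psi>(1) this a fin show thesis by (rule that)
  qed
qed

end

subsection \<open>Ultrafilters\<close>

definition is_ultrafilter :: "'a filter \<Rightarrow> bool" where
  "is_ultrafilter F \<longleftrightarrow> F \<noteq> bot \<and> (\<forall>P. eventually P F \<or> eventually (\<lambda>x. \<not> P x) F)"

text \<open>Zorn's lemma for proper filters, finer ones counting as larger. The infimum of a chain
  is proper because an event of it already belongs to a member. A finest proper filter decides every
  \<open>P\<close>: if it does not contain the complement, adjoining \<open>P\<close> keeps it
  proper.\<close>

lemma ex_ultrafilter_le:
  fixes F :: "'a filter"
  assumes "F \<noteq> bot"
  shows "\<exists>G\<le>F. is_ultrafilter G"
proof -
  let ?A = "{G. G \<noteq> bot \<and> G \<le> F}"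
  let ?R = "\<lambda>G H. H \<le> (G :: 'a filter)"
  have "\<exists>M\<in>?A. \<forall>G\<in>?A. ?R M G \<longrightarrow> G = M"
  proof (rule predicate_Zorn)
    show "partial_order_on ?A (relation_of ?R ?A)"
      by (rule partial_order_on_relation_ofI) auto
    fix C assume C: "C \<in> Chains (relation_of ?R ?A)"
    show "\<exists>u\<in>?A. \<forall>G\<in>C. ?R G u"
    proof (cases "C = {}")
      case True
      then show ?thesis using assms by auto
    next
      case False
      have sub: "C \<subseteq> ?A" using C by (auto simp: Chains_def relation_of_def)
      have "\<exists>K\<in>C. K \<le> inf G H" if "G \<in> C" "H \<in> C" for G H
        using C that by (auto simp: Chains_def relation_of_def)
      then have "eventually P (Inf C) \<longleftrightarrow> (\<exists>G\<in>C. eventually P G)" for P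
        by (rule eventually_Inf_base[OF False])
      then have "Inf C \<noteq> bot" using sub by (auto simp: trivial_limit_def)
      moreover have "Inf C \<le> F" using False sub by (auto intro: Inf_lower2)
      ultimately show ?thesis by (auto intro: Inf_lower)
    qed
  qed
  then obtain M where M: "M \<noteq> bot" "M \<le> F" and max: "\<And>G. G \<noteq> bot \<Longrightarrow> G \<le> M \<Longrightarrow> G = M"
    by (auto intro: order_trans)
  have "eventually P M" if "\<not> eventually (\<lambda>x. \<not> P x) M" for P
  proof -
    have "inf M (principal {x. P x}) \<noteq> bot"
      using that by (auto simp: trivial_limit_def eventually_inf_principal)
    then have "inf M (principal {x. P x}) = M" by (rule max) simp
    moreover have "eventually P (inf M (principal {x. P x}))"
      by (simp add: eventually_inf_principal)
    ultimately show ?thesis by simp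
  qed
  then show ?thesis using M unfolding is_ultrafilter_def by blast
qed

text \<open>The image filter lives on a compact set and so has a cluster point, to which an
  ultrafilter must converge.\<close>

lemma ultrafilter_convergent:
  fixes f :: "'a \<Rightarrow> 'k::heine_borel"
  assumes \<U>: "is_ultrafilter \<U>" and "bounded (range f)"
  shows "\<exists>l. (f \<longlongrightarrow> l) \<U>"
proof -
  have "compact (closure (range f))" using assms by (simp add: compact_closure)
  moreover have "filtermap f \<U> \<noteq> bot" using \<U> by (simp add: filtermap_bot_iff is_ultrafilter_def)
  moreover have "eventually (\<lambda>x. x \<in> closure (range f)) (filtermap f \<U>)"
    using closure_subset[of "range f"] by (auto simp: eventually_filtermap intro!: always_eventually)
  ultimately obtain l where l: "inf (nhds l) (filtermap f \<U>) \<noteq> bot"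
    unfolding compact_filter by blast
  have "eventually (\<lambda>n. f n \<in> S) \<U>" if "open S" "l \<in> S" for S
  proof (rule ccontr)
    assume "\<not> eventually (\<lambda>n. f n \<in> S) \<U>"
    then have "eventually (\<lambda>n. \<not> f n \<in> S) \<U>" using \<U> unfolding is_ultrafilter_def by blast
    then have "eventually (\<lambda>x. x \<notin> S) (filtermap f \<U>)" by (simp add: eventually_filtermap)
    moreover have "eventually (\<lambda>x. x \<in> S) (nhds l)" using that by (rule eventually_nhds_in_open)
    ultimately have "eventually (\<lambda>x. False) (inf (nhds l) (filtermap f \<U>))"
      unfolding eventually_inf by blast
    then show False using l by (simp add: trivial_limit_def)
  qed
  then show ?thesis unfolding tendsto_def by blast
qed

text \<open>The limit of \<open>f (b n)\<close> along the ultrafilter exists for all functionals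
  \<open>f\<close> at once, and linearity and the norm bound pass to it. This is weak-star
  compactness of the bidual ball, applied to a sequence from \<open>X\<close>.\<close>

lemma (in normed_space) ex_ultrafilter_bidual_limit:
  assumes \<U>: "is_ultrafilter \<U>" and b: "\<And>n. b n \<in> unit_ball X"
  shows "\<exists>\<phi>\<in>unit_ball (dual (dual X)). bounded_net_wstar_to X (filtermap b \<U>) \<phi>"
proof -
  have bot: "\<U> \<noteq> bot" using \<U> by (simp add: is_ultrafilter_def)
  interpret V: normed_space "dual X" by (rule normed_space_dual)
  define \<phi> where "\<phi> f = (if f \<in> carrier (dual X) then Lim \<U> (\<lambda>n. f (b n)) else 0)" for f
  have bn: "b n \<in> carrier X" "nrm X (b n) \<le> 1" for n using b[of n] by (auto simp: unit_ball_def)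
  have le: "norm (f (b n)) \<le> nrm (dual X) f" if f: "f \<in> carrier (dual X)" for f n
    using dual_bound[OF f bn(1)[of n]] mult_left_mono[OF bn(2)[of n] dual_norm_nonneg[OF f]] by simp
  have lim: "((\<lambda>n. f (b n)) \<longlongrightarrow> \<phi> f) \<U>" if f: "f \<in> carrier (dual X)" for f
  proof -
    have "bounded (range (\<lambda>n. f (b n)))" using le[OF f] by (auto intro: boundedI)
    then obtain l where "((\<lambda>n. f (b n)) \<longlongrightarrow> l) \<U>" using ultrafilter_convergent[OF \<U>] by blast
    then show ?thesis using f bot by (simp add: \<phi>_def tendsto_Lim)
  qed
  have uniq: "\<phi> f = l" if "((\<lambda>n. f (b n)) \<longlongrightarrow> l) \<U>" "f \<in> carrier (dual X)" for f l
    using tendsto_unique[OF bot lim[OF that(2)] that(1)] .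
  have bound: "norm (\<phi> f) \<le> 1 * nrm (dual X) f" if "f \<in> carrier (dual X)" for f
    using tendsto_upperbound[OF tendsto_norm[OF lim[OF that]] _ bot, of "nrm (dual X) f"] le[OF that] by simp
  have "\<phi> \<in> carrier (dual (dual X))"
  proof (rule V.dualI[OF _ _ _ bound])
    fix f g c assume f: "f \<in> carrier (dual X)"
    show "\<phi> (c \<odot>\<^bsub>dual X\<^esub> f) = c * \<phi> f"
      using uniq[OF tendsto_mult_left[OF lim[OF f], of c]] V.smult_closed'[OF f, of c] by simp
    assume g: "g \<in> carrier (dual X)"
    show "\<phi> (f \<oplus>\<^bsub>dual X\<^esub> g) = \<phi> f + \<phi> g"
      using uniq[OF tendsto_add[OF lim[OF f] lim[OF g]]] V.M.a_closed[OF f g] by simp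
  qed (simp_all add: \<phi>_def)
  moreover have "nrm (dual (dual X)) \<phi> \<le> 1"
    by (rule V.dual_norm_le[OF _ bound]) simp_all
  moreover have "bounded_net_wstar_to X (filtermap b \<U>) \<phi>"
    unfolding bounded_net_wstar_to_def
    using bn lim bot by (auto simp: filtermap_bot_iff eventually_filtermap filterlim_filtermap intro!: exI[of _ 1])
  ultimately show ?thesis by (auto simp: unit_ball_def)
qed

subsection \<open>Arens extensions as iterated evaluations\<close>

text \<open>The coordinates form an arbitrary index set and continuity is replaced by a norm bound,
  so that coordinates can be evaluated away one at a time.\<close>

definition bounded_multilinear ::
  "nat set \<Rightarrow> (nat \<Rightarrow> ('k::{real_normed_field, euclidean_space}, 'u) nspace) \<Rightarrow> ((nat \<Rightarrow> 'u) \<Rightarrow> 'k) \<Rightarrow> bool" where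
  "bounded_multilinear I X G \<longleftrightarrow>
    (\<forall>x\<in>\<Pi>\<^sub>E i\<in>I. carrier (X i). \<forall>i\<in>I. \<forall>u\<in>carrier (X i). \<forall>v\<in>carrier (X i).
      G (x(i := u \<oplus>\<^bsub>X i\<^esub> v)) = G (x(i := u)) + G (x(i := v))) \<and>
    (\<forall>x\<in>\<Pi>\<^sub>E i\<in>I. carrier (X i). \<forall>i\<in>I. \<forall>u\<in>carrier (X i). \<forall>a. G (x(i := a \<odot>\<^bsub>X i\<^esub> u)) = a * G (x(i := u))) \<and>
    (\<exists>C\<ge>0. \<forall>x\<in>\<Pi>\<^sub>E i\<in>I. carrier (X i). norm (G x) \<le> C * (\<Prod>i\<in>I. nrm (X i) (x i)))"

lemma bounded_multilinear_bound:
  "bounded_multilinear I X G \<Longrightarrow>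
    \<exists>C\<ge>0. \<forall>x\<in>\<Pi>\<^sub>E i\<in>I. carrier (X i). norm (G x) \<le> C * (\<Prod>i\<in>I. nrm (X i) (x i))"
  by (simp add: bounded_multilinear_def)

text \<open>The value 0 off the carrier is the convention under which functionals belong to
  \<open>dual\<close>.\<close>

definition slice :: "(nat \<Rightarrow> ('k::{real_normed_field, euclidean_space}, 'u) nspace) \<Rightarrow> ((nat \<Rightarrow> 'u) \<Rightarrow> 'k) \<Rightarrow>
    nat \<Rightarrow> (nat \<Rightarrow> 'u) \<Rightarrow> 'u \<Rightarrow> 'k" where
  "slice X G j x = (\<lambda>y. if y \<in> carrier (X j) then G (x(j := y)) else 0)"

text \<open>This is the Arens extension without nets. The head of the list is evaluated last,
  matching the outermost limit of \<open>iterated_lim\<close>.\<close>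

primrec iterated_eval :: "(nat \<Rightarrow> ('k::{real_normed_field, euclidean_space}, 'u) nspace) \<Rightarrow>
    (nat \<Rightarrow> ('u \<Rightarrow> 'k) \<Rightarrow> 'k) \<Rightarrow> ((nat \<Rightarrow> 'u) \<Rightarrow> 'k) \<Rightarrow> nat list \<Rightarrow> (nat \<Rightarrow> 'u) \<Rightarrow> 'k" where
  "iterated_eval X \<phi> G [] x = G x"
| "iterated_eval X \<phi> G (j # js) x = \<phi> j (slice X (iterated_eval X \<phi> G js) j x)"

context
  fixes X :: "nat \<Rightarrow> ('k::{real_normed_field, euclidean_space}, 'u) nspace"
    and j :: nat and I :: "nat set" and G :: "(nat \<Rightarrow> 'u) \<Rightarrow> 'k"
  assumes Xj: "normed_space (X j)" and XI: "\<And>i. i \<in> I \<Longrightarrow> normed_space (X i)"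
    and G: "bounded_multilinear (insert j I) X G" and j: "j \<notin> I" and fin: "finite I"
begin

interpretation Xj: normed_space "X j" by (rule Xj)

lemma slice_dual:
  assumes C: "C \<ge> 0" "\<And>x. x \<in> (\<Pi>\<^sub>E i\<in>insert j I. carrier (X i)) \<Longrightarrow> norm (G x) \<le> C * (\<Prod>i\<in>insert j I. nrm (X i) (x i))"
    and x: "x \<in> (\<Pi>\<^sub>E i\<in>I. carrier (X i))"
  shows "slice X G j x \<in> carrier (dual (X j))"
    and "nrm (dual (X j)) (slice X G j x) \<le> C * (\<Prod>i\<in>I. nrm (X i) (x i))"
proof -
  have upd: "x(j := y) \<in> (\<Pi>\<^sub>E i\<in>insert j I. carrier (X i))" if "y \<in> carrier (X j)" for y
    using x that by (auto simp: PiE_iff extensional_def)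
  have bound: "norm (slice X G j x y) \<le> C * (\<Prod>i\<in>I. nrm (X i) (x i)) * nrm (X j) y" if y: "y \<in> carrier (X j)" for y
  proof -
    have "(\<Prod>i\<in>I. nrm (X i) ((x(j := y)) i)) = (\<Prod>i\<in>I. nrm (X i) (x i))"
      using j by (intro prod.cong) auto
    then show ?thesis
      using C(2)[OF upd[OF y]] fin j y by (simp add: slice_def mult_ac)
  qed
  show "slice X G j x \<in> carrier (dual (X j))"
  proof (rule Xj.dualI[OF _ _ _ bound])
    fix u v a assume u: "u \<in> carrier (X j)"
    then show "slice X G j x (a \<odot>\<^bsub>X j\<^esub> u) = a * slice X G j x u"
      using G upd[OF u] by (auto simp: slice_def bounded_multilinear_def)
    assume v: "v \<in> carrier (X j)"
    show "slice X G j x (u \<oplus>\<^bsub>X j\<^esub> v) = slice X G j x u + slice X G j x v"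
      using G upd[OF u] u v by (auto simp: slice_def bounded_multilinear_def)
  qed (simp_all add: slice_def)
  show "nrm (dual (X j)) (slice X G j x) \<le> C * (\<Prod>i\<in>I. nrm (X i) (x i))"
  proof (rule Xj.dual_norm_le[OF _ bound])
    show "0 \<le> C * (\<Prod>i\<in>I. nrm (X i) (x i))"
      using C(1) x by (intro mult_nonneg_nonneg prod_nonneg ballI normed_space.nrm_nonneg[OF XI]) auto
  qed
qed

lemma slice_mem:
  assumes "x \<in> (\<Pi>\<^sub>E i\<in>I. carrier (X i))"
  shows "slice X G j x \<in> carrier (dual (X j))"
proof -
  obtain C where C: "C \<ge> 0" "\<And>x. x \<in> (\<Pi>\<^sub>E i\<in>insert j I. carrier (X i)) \<Longrightarrow> norm (G x) \<le> C * (\<Prod>i\<in>insert j I. nrm (X i) (x i))"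
    using bounded_multilinear_bound[OF G] by blast
  show ?thesis by (rule slice_dual(1)[OF C assms])
qed

text \<open>The slice depends linearly on the remaining coordinates and its norm is at most a
  constant times the product of their norms. Applying \<phi> keeps the linearity and multiplies the
  constant by the norm of \<phi>.\<close>

lemma bounded_multilinear_eval:
  assumes \<phi>: "\<phi> \<in> carrier (dual (dual (X j)))"
  shows "bounded_multilinear I X (\<lambda>x. \<phi> (slice X G j x))"
proof -
  interpret V: normed_space "dual (X j)" by (rule Xj.normed_space_dual)
  have upd: "x(i := u) \<in> (\<Pi>\<^sub>E i\<in>I. carrier (X i))"
    if "x \<in> (\<Pi>\<^sub>E i\<in>I. carrier (X i))" "i \<in> I" "u \<in> carrier (X i)" for x i u
    using that by (auto simp: PiE_iff extensional_def)
  have updj: "x(j := y) \<in> (\<Pi>\<^sub>E i\<in>insert j I. carrier (X i))"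
    if "x \<in> (\<Pi>\<^sub>E i\<in>I. carrier (X i))" "y \<in> carrier (X j)" for x y
    using that by (auto simp: PiE_iff extensional_def)
  note G' = G[unfolded bounded_multilinear_def]
  have add: "\<phi> (slice X G j (x(i := u \<oplus>\<^bsub>X i\<^esub> v))) = \<phi> (slice X G j (x(i := u))) + \<phi> (slice X G j (x(i := v)))"
    if x: "x \<in> (\<Pi>\<^sub>E i\<in>I. carrier (X i))" and i: "i \<in> I" and u: "u \<in> carrier (X i)" and v: "v \<in> carrier (X i)" for x i u v
  proof -
    have ij: "i \<noteq> j" using i j by blast
    have "slice X G j (x(i := u \<oplus>\<^bsub>X i\<^esub> v)) = slice X G j (x(i := u)) \<oplus>\<^bsub>dual (X j)\<^esub> slice X G j (x(i := v))"
    proof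
      fix y
      show "slice X G j (x(i := u \<oplus>\<^bsub>X i\<^esub> v)) y = (slice X G j (x(i := u)) \<oplus>\<^bsub>dual (X j)\<^esub> slice X G j (x(i := v))) y"
        using conjunct1[OF G', rule_format, OF updj[OF x] insertI2[OF i] u v, of y] ij
        by (simp add: slice_def fun_upd_twist)
    qed
    then show ?thesis
      using V.dual_add[OF \<phi> slice_mem[OF upd[OF x i u]] slice_mem[OF upd[OF x i v]]] by simp
  qed
  have smult: "\<phi> (slice X G j (x(i := a \<odot>\<^bsub>X i\<^esub> u))) = a * \<phi> (slice X G j (x(i := u)))"
    if x: "x \<in> (\<Pi>\<^sub>E i\<in>I. carrier (X i))" and i: "i \<in> I" and u: "u \<in> carrier (X i)" for x i u a
  proof -
    have ij: "i \<noteq> j" using i j by blast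
    have "slice X G j (x(i := a \<odot>\<^bsub>X i\<^esub> u)) = a \<odot>\<^bsub>dual (X j)\<^esub> slice X G j (x(i := u))"
    proof
      fix y
      show "slice X G j (x(i := a \<odot>\<^bsub>X i\<^esub> u)) y = (a \<odot>\<^bsub>dual (X j)\<^esub> slice X G j (x(i := u))) y"
        using conjunct1[OF conjunct2[OF G'], rule_format, OF updj[OF x] insertI2[OF i] u, of y a] ij
        by (simp add: slice_def fun_upd_twist)
    qed
    then show ?thesis
      using V.dual_smult[OF \<phi> slice_mem[OF upd[OF x i u]]] by simp
  qed
  obtain C where C: "C \<ge> 0" "\<And>x. x \<in> (\<Pi>\<^sub>E i\<in>insert j I. carrier (X i)) \<Longrightarrow> norm (G x) \<le> C * (\<Prod>i\<in>insert j I. nrm (X i) (x i))"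
    using bounded_multilinear_bound[OF G] by blast
  have "norm (\<phi> (slice X G j x)) \<le> nrm (dual (dual (X j))) \<phi> * C * (\<Prod>i\<in>I. nrm (X i) (x i))"
    if x: "x \<in> (\<Pi>\<^sub>E i\<in>I. carrier (X i))" for x
    using V.dual_bound[OF \<phi> slice_dual(1)[OF C x]]
      mult_left_mono[OF slice_dual(2)[OF C x] V.dual_norm_nonneg[OF \<phi>]] by (simp add: mult.assoc)
  moreover have "0 \<le> nrm (dual (dual (X j))) \<phi> * C"
    using C(1) V.dual_norm_nonneg[OF \<phi>] by simp
  ultimately show ?thesis
    unfolding bounded_multilinear_def using add smult by blast
qed

end

text \<open>By induction with \<open>insert j I\<close>, the inner iterated limit is, as a function
  of coordinate \<open>j\<close>, a slice in the dual of \<open>X j\<close>; weak-star convergence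
  along \<open>F j\<close> then evaluates it. The \<open>case\<close> clause records that
  \<open>Lim\<close> is here a genuine limit.\<close>

lemma iterated_lim_eq_iterated_eval:
  assumes "\<And>i. i \<in> set js \<union> I \<Longrightarrow> normed_space (X i)" "finite I" "distinct js" "set js \<inter> I = {}"
    and "bounded_multilinear (set js \<union> I) X G"
    and "\<And>i. i \<in> set js \<Longrightarrow> \<phi> i \<in> carrier (dual (dual (X i)))"
    and "\<And>i. i \<in> set js \<Longrightarrow> bounded_net_wstar_to (X i) (F i) (\<phi> i)"
  shows "bounded_multilinear I X (iterated_eval X \<phi> G js) \<and>
    (\<forall>x\<in>\<Pi>\<^sub>E i\<in>I. carrier (X i). iterated_lim F G js x = iterated_eval X \<phi> G js x \<and>
      (case js of [] \<Rightarrow> True | j # ks \<Rightarrow> ((\<lambda>y. iterated_lim F G ks (x(j := y))) \<longlongrightarrow> iterated_lim F G js x) (F j)))"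
  using assms
proof (induction js arbitrary: I)
  case Nil
  then show ?case by simp
next
  case (Cons j js)
  let ?H = "iterated_eval X \<phi> G js"
  have H: "bounded_multilinear (insert j I) X ?H"
    and eq: "\<And>x. x \<in> (\<Pi>\<^sub>E i\<in>insert j I. carrier (X i)) \<Longrightarrow> iterated_lim F G js x = ?H x"
    using Cons.IH[of "insert j I"] Cons.prems by auto
  have j: "normed_space (X j)" "j \<notin> I" "\<phi> j \<in> carrier (dual (dual (X j)))" "bounded_net_wstar_to (X j) (F j) (\<phi> j)"
    and XI: "\<And>i. i \<in> I \<Longrightarrow> normed_space (X i)"
    using Cons.prems by auto
  have lim: "((\<lambda>y. iterated_lim F G js (x(j := y))) \<longlongrightarrow> \<phi> j (slice X ?H j x)) (F j)"
    if x: "x \<in> (\<Pi>\<^sub>E i\<in>I. carrier (X i))" for x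
  proof (rule Lim_transform_eventually)
    show "(slice X ?H j x \<longlongrightarrow> \<phi> j (slice X ?H j x)) (F j)"
      using j(4) slice_mem[OF j(1) XI H j(2) \<open>finite I\<close> x] by (auto simp: bounded_net_wstar_to_def)
    have "\<forall>\<^sub>F y in F j. y \<in> carrier (X j)"
      using j(4) by (auto simp: bounded_net_wstar_to_def elim: eventually_mono)
    then show "\<forall>\<^sub>F y in F j. slice X ?H j x y = iterated_lim F G js (x(j := y))"
    proof eventually_elim
      case (elim y)
      then have "x(j := y) \<in> (\<Pi>\<^sub>E i\<in>insert j I. carrier (X i))"
        using x by (auto simp: PiE_iff extensional_def)
      then show ?case using elim by (simp add: slice_def eq)
    qed
  qed
  have "F j \<noteq> bot" using j(4) by (simp add: bounded_net_wstar_to_def)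
  then have "Lim (F j) (\<lambda>y. iterated_lim F G js (x(j := y))) = \<phi> j (slice X ?H j x)"
    if "x \<in> (\<Pi>\<^sub>E i\<in>I. carrier (X i))" for x
    using lim[OF that] by (rule tendsto_Lim)
  then show ?case
    using bounded_multilinear_eval[OF j(1) XI H j(2) \<open>finite I\<close> j(3)] lim by simp
qed

text \<open>All admissible nets give the value of \<open>iterated_eval\<close>, which depends only
  on the point of the bidual, so the definite description has exactly one candidate.\<close>

lemma arens_extension_eq_iterated_lim:
  assumes X: "\<And>i. i \<in> {1..N} \<Longrightarrow> normed_space (X i)"
    and \<Phi>: "bounded_multilinear {1..N} X \<Phi>" and \<sigma>: "\<sigma> permutes {1..N}"
    and \<phi>: "\<And>i. i \<in> {1..N} \<Longrightarrow> \<phi> i \<in> carrier (dual (dual (X i)))"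
    and F: "\<And>i. i \<in> {1..N} \<Longrightarrow> bounded_net_wstar_to (X i) (F i) (\<phi> i)"
  shows "arens_extension N X \<Phi> \<sigma> \<phi> = iterated_lim F \<Phi> (map \<sigma> [1..<N + 1]) (\<lambda>_. undefined)"
proof -
  define js where "js = map \<sigma> [1..<N + 1]"
  have set: "set js = {1..N}"
  proof -
    have "{1..<N + 1} = {1..N}" by auto
    then show ?thesis unfolding js_def set_map set_upt by (simp only: permutes_image[OF \<sigma>])
  qed
  have dist: "distinct js"
    using permutes_inj_on[OF \<sigma>] by (simp add: js_def distinct_map)
  have eval: "iterated_lim F' \<Phi> js (\<lambda>_. undefined) = iterated_eval X \<phi> \<Phi> js (\<lambda>_. undefined)"
    if "\<And>i. i \<in> {1..N} \<Longrightarrow> bounded_net_wstar_to (X i) (F' i) (\<phi> i)" for F'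
  proof -
    have "bounded_multilinear {} X (iterated_eval X \<phi> \<Phi> js) \<and>
      (\<forall>x\<in>\<Pi>\<^sub>E i\<in>{}. carrier (X i). iterated_lim F' \<Phi> js x = iterated_eval X \<phi> \<Phi> js x \<and>
        (case js of [] \<Rightarrow> True | j # ks \<Rightarrow> ((\<lambda>y. iterated_lim F' \<Phi> ks (x(j := y))) \<longlongrightarrow> iterated_lim F' \<Phi> js x) (F' j)))"
      by (rule iterated_lim_eq_iterated_eval) (use X \<Phi> \<phi> that dist set in simp_all)
    then show ?thesis by simp
  qed
  show ?thesis
    unfolding arens_extension_def js_def[symmetric]
  proof (rule the_equality)
    show "\<exists>F'. (\<forall>i\<in>{1..N}. bounded_net_wstar_to (X i) (F' i) (\<phi> i)) \<and>
      iterated_lim F \<Phi> js (\<lambda>_. undefined) = iterated_lim F' \<Phi> js (\<lambda>_. undefined)"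
      using F by blast
    fix L
    assume "\<exists>F'. (\<forall>i\<in>{1..N}. bounded_net_wstar_to (X i) (F' i) (\<phi> i)) \<and> L = iterated_lim F' \<Phi> js (\<lambda>_. undefined)"
    then show "L = iterated_lim F \<Phi> js (\<lambda>_. undefined)"
      using eval eval[OF F] by auto
  qed
qed

text \<open>For fixed \<open>m\<close> the bound on the sum of defects survives the limits in
  \<open>k\<close> and then in \<open>n\<close>, as m \<le> n < k holds eventually along \<U>. Being
  uniform in \<open>m\<close>, it makes the defects of \<open>f1\<close> summable; so they tend to
  0, and the outer limit has norm \<open>s\<close>.\<close>

lemma norm_iterated_limit_eq:
  fixes f :: "nat \<Rightarrow> nat \<Rightarrow> nat \<Rightarrow> 'a::real_normed_vector"
  assumes \<U>: "\<U> \<noteq> bot" "\<U> \<le> sequentially"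
    and f3: "\<And>i n. (f i n \<longlongrightarrow> f2 i n) \<U>" and f2: "\<And>i. (f2 i \<longlongrightarrow> f1 i) \<U>" and f1: "(f1 \<longlongrightarrow> L) \<U>"
    and le: "\<And>i n k. norm (f i n k) \<le> s"
    and sum: "\<And>m n k. m \<le> n \<Longrightarrow> n < k \<Longrightarrow> (\<Sum>i<m. s - norm (f i n k)) \<le> C"
  shows "norm L = s"
proof -
  have ev: "eventually P \<U>" if "eventually P sequentially" for P
    using that \<U>(2) by (simp add: le_filter_def)
  have sum2: "(\<Sum>i<m. s - norm (f2 i n)) \<le> C" if "m \<le> n" for m n
  proof (rule tendsto_upperbound[OF _ _ \<U>(1)])
    show "((\<lambda>k. \<Sum>i<m. s - norm (f i n k)) \<longlongrightarrow> (\<Sum>i<m. s - norm (f2 i n))) \<U>"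
      by (intro tendsto_intros f3)
    show "\<forall>\<^sub>F k in \<U>. (\<Sum>i<m. s - norm (f i n k)) \<le> C"
      by (rule ev, rule eventually_mono[OF eventually_gt_at_top[of n]], rule sum[OF that])
  qed
  have sum1: "(\<Sum>i<m. s - norm (f1 i)) \<le> C" for m
  proof (rule tendsto_upperbound[OF _ _ \<U>(1)])
    show "((\<lambda>n. \<Sum>i<m. s - norm (f2 i n)) \<longlongrightarrow> (\<Sum>i<m. s - norm (f1 i))) \<U>"
      by (intro tendsto_intros f2)
    show "\<forall>\<^sub>F n in \<U>. (\<Sum>i<m. s - norm (f2 i n)) \<le> C"
      by (rule ev, rule eventually_mono[OF eventually_ge_at_top[of m]], rule sum2)
  qed
  have "norm (f2 i n) \<le> s" for i n
    using tendsto_upperbound[OF tendsto_norm[OF f3] _ \<U>(1)] le by simp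
  then have le1: "norm (f1 i) \<le> s" for i
    using tendsto_upperbound[OF tendsto_norm[OF f2] _ \<U>(1)] by simp
  have "summable (\<lambda>i. s - norm (f1 i))"
    using le1 sum1 by (intro summableI_nonneg_bounded[of _ C]) simp_all
  then have "(\<lambda>i. s - norm (f1 i)) \<longlonglongrightarrow> 0" by (rule summable_LIMSEQ_zero)
  then have "((\<lambda>i. s - norm (f1 i)) \<longlongrightarrow> 0) \<U>" using \<U>(2) by (rule filterlim_mono[OF _ order_refl])
  moreover have "((\<lambda>i. s - norm (f1 i)) \<longlongrightarrow> s - norm L) \<U>"
    by (intro tendsto_intros f1)
  ultimately show ?thesis using tendsto_unique[OF \<U>(1)] by fastforce
qed

section \<open>Norm attainment by the Arens extensions of forms in an ideal\<close>

context normed_ideal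
begin

lemma bounded_multilinear_form:
  assumes X: "X \<in> banach_tuples N" and \<Phi>: "\<Phi> \<in> U X"
  shows "bounded_multilinear {1..N} X \<Phi>"
  unfolding bounded_multilinear_def tuples_def[symmetric]
  using multilinear_add[OF multilinear[OF X \<Phi>]] multilinear_smult[OF multilinear[OF X \<Phi>]]
    form_bound[OF X \<Phi>] nU_nonneg[OF X \<Phi>] by blast

end

text \<open>One ultrafilter serves all coordinates, so the bidual tuple does not depend on \<sigma>.
  For the order c, d, e the coordinates come from \<open>a i\<close>, \<open>a n\<close>,
  \<open>a k\<close> respectively, and the sums bounded for the pair \<open>(c, d)\<close> are those
  that \<open>norm_iterated_limit_eq\<close> requires.\<close>

lemma arens_attain_if_summable_defects:
  fixes a :: "nat \<Rightarrow> nat \<Rightarrow> 'k::{real_normed_field, euclidean_space} + 'u"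
  assumes "normed_ideal 3 U nU" and X: "X \<in> banach_tuples 3" and \<Phi>: "\<Phi> \<in> U X"
    and a: "\<And>n. a n \<in> ball_tuples 3 X"
    and sum: "\<And>c d m n k. (c, d) \<in> index_pairs 3 \<Longrightarrow> m \<le> n \<Longrightarrow> n < k \<Longrightarrow>
      (\<Sum>i<m. sup_norm 3 X \<Phi> - norm (\<Phi> ((a k)(c := a i c, d := a n d)))) \<le> C"
  shows "arens_attain_at_same_tuple 3 X \<Phi>"
proof -
  interpret normed_ideal 3 U nU by fact
  obtain \<U> :: "nat filter" where \<U>: "\<U> \<le> sequentially" "is_ultrafilter \<U>"
    using ex_ultrafilter_le[OF sequentially_bot] by blast
  have bot: "\<U> \<noteq> bot" using \<U>(2) by (simp add: is_ultrafilter_def)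
  define F where "F i = filtermap (\<lambda>n. a n i) \<U>" for i
  have "\<forall>i\<in>{1..3}. \<exists>\<phi>. \<phi> \<in> unit_ball (dual (dual (X i))) \<and> bounded_net_wstar_to (X i) (F i) \<phi>"
  proof
    fix i :: nat assume i: "i \<in> {1..3}"
    show "\<exists>\<phi>. \<phi> \<in> unit_ball (dual (dual (X i))) \<and> bounded_net_wstar_to (X i) (F i) \<phi>"
      using normed_space.ex_ultrafilter_bidual_limit[where b = "\<lambda>n. a n i", OF normed_component[OF X i] \<U>(2) ball_tuplesD[OF a i]]
      unfolding F_def by blast
  qed
  then obtain \<phi>' where \<phi>': "\<And>i. i \<in> {1..3} \<Longrightarrow> \<phi>' i \<in> unit_ball (dual (dual (X i)))"
    "\<And>i. i \<in> {1..3} \<Longrightarrow> bounded_net_wstar_to (X i) (F i) (\<phi>' i)"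
    by metis
  define \<phi> where "\<phi> = restrict \<phi>' {1..3}"
  have \<phi>: "\<phi> i \<in> unit_ball (dual (dual (X i)))" "bounded_net_wstar_to (X i) (F i) (\<phi> i)" if "i \<in> {1..3}" for i
    using \<phi>'[OF that] that by (simp_all add: \<phi>_def)
  have \<phi>c: "\<phi> i \<in> carrier (dual (dual (X i)))" if "i \<in> {1..3}" for i
    using \<phi>(1)[OF that] by (simp add: unit_ball_def)
  note bm = bounded_multilinear_form[OF X \<Phi>]
  let ?u = "\<lambda>_. undefined"
  have "norm (arens_extension 3 X \<Phi> \<sigma> \<phi>) = sup_norm 3 X \<Phi>" if \<sigma>: "\<sigma> permutes {1..3}" for \<sigma>
  proof -
    define c d e where "c = \<sigma> 1" and "d = \<sigma> 2" and "e = \<sigma> 3"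
    have cde: "{c, d, e} = {1..3}" "c \<noteq> d" "c \<noteq> e" "d \<noteq> e"
    proof -
      have "{1..3} = {1, 2, 3 :: nat}" by auto
      then show "{c, d, e} = {1..3}" using permutes_image[OF \<sigma>] by (simp add: c_def d_def e_def)
      show "c \<noteq> d" "c \<noteq> e" "d \<noteq> e"
        using permutes_inj[OF \<sigma>] by (auto simp: c_def d_def e_def inj_eq)
    qed
    have mem: "c \<in> {1..3}" "d \<in> {1..3}" "e \<in> {1..3}" using cde(1) by auto
    have js: "map \<sigma> [1..<3 + 1] = [c, d, e]"
      by (simp add: c_def d_def e_def upt_rec numeral_2_eq_2 numeral_3_eq_3)
    have ac: "a i j \<in> carrier (X j)" if "j \<in> {1..3}" for i j
      using tuplesD[OF ball_tuples_tuples[OF a] that] .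
    \<comment> \<open>A limit along \<open>F j\<close> is a limit along \<U> of the
      \<open>j\<close>-th coordinates of the sequence.\<close>
    have lim: "((\<lambda>n. iterated_lim F \<Phi> ks (x(j := a n j))) \<longlongrightarrow> iterated_lim F \<Phi> (j # ks) x) \<U>"
      if "set (j # ks) \<union> I = {1..3}" "distinct (j # ks)" "set (j # ks) \<inter> I = {}" "x \<in> (\<Pi>\<^sub>E i\<in>I. carrier (X i))" for j ks I x
    proof -
      have "I \<subseteq> {1..3}" using that(1) by blast
      then have "finite I" by (rule finite_subset) simp
      have "bounded_multilinear I X (iterated_eval X \<phi> \<Phi> (j # ks)) \<and>
        (\<forall>x\<in>\<Pi>\<^sub>E i\<in>I. carrier (X i). iterated_lim F \<Phi> (j # ks) x = iterated_eval X \<phi> \<Phi> (j # ks) x \<and>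
          (case j # ks of [] \<Rightarrow> True | j' # ks' \<Rightarrow>
            ((\<lambda>y. iterated_lim F \<Phi> ks' (x(j' := y))) \<longlongrightarrow> iterated_lim F \<Phi> (j # ks) x) (F j')))"
      proof (rule iterated_lim_eq_iterated_eval[OF _ \<open>finite I\<close> that(2,3)])
        show "bounded_multilinear (set (j # ks) \<union> I) X \<Phi>" unfolding that(1) by (rule bm)
        show "normed_space (X i)" if "i \<in> set (j # ks) \<union> I" for i
          using that \<open>set (j # ks) \<union> I = {1..3}\<close> normed_component[OF X] by blast
        show "\<phi> i \<in> carrier (dual (dual (X i)))" "bounded_net_wstar_to (X i) (F i) (\<phi> i)" if "i \<in> set (j # ks)" for i
          using that \<open>set (j # ks) \<union> I = {1..3}\<close> \<phi>c \<phi>(2) by blast+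
      qed
      then have "((\<lambda>y. iterated_lim F \<Phi> ks (x(j := y))) \<longlongrightarrow> iterated_lim F \<Phi> (j # ks) x) (F j)"
        using that(4) by auto
      then show ?thesis unfolding F_def filterlim_filtermap .
    qed
    have "norm (iterated_lim F \<Phi> [c, d, e] ?u) = sup_norm 3 X \<Phi>"
    proof (rule norm_iterated_limit_eq[OF bot \<U>(1),
          where f = "\<lambda>i n k. \<Phi> (?u(c := a i c, d := a n d, e := a k e))"
            and ?f2.0 = "\<lambda>i n. iterated_lim F \<Phi> [e] (?u(c := a i c, d := a n d))"
            and ?f1.0 = "\<lambda>i. iterated_lim F \<Phi> [d, e] (?u(c := a i c))"])
      show "((\<lambda>i. iterated_lim F \<Phi> [d, e] (?u(c := a i c))) \<longlongrightarrow> iterated_lim F \<Phi> [c, d, e] ?u) \<U>"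
        by (rule lim[of c "[d, e]" "{}" ?u]) (use cde in auto)
      show "((\<lambda>n. iterated_lim F \<Phi> [e] (?u(c := a i c, d := a n d))) \<longlongrightarrow> iterated_lim F \<Phi> [d, e] (?u(c := a i c))) \<U>" for i
        by (rule lim[of d "[e]" "{c}"]) (use cde ac[OF mem(1)] in auto)
      show "((\<lambda>k. \<Phi> (?u(c := a i c, d := a n d, e := a k e))) \<longlongrightarrow> iterated_lim F \<Phi> [e] (?u(c := a i c, d := a n d))) \<U>" for i n
      proof -
        have "?u(c := a i c, d := a n d) \<in> (\<Pi>\<^sub>E i\<in>{c, d}. carrier (X i))"
          by (simp add: PiE_iff extensional_def ac[OF mem(1)] ac[OF mem(2)])
        then have "((\<lambda>k. iterated_lim F \<Phi> [] (?u(c := a i c, d := a n d, e := a k e))) \<longlongrightarrow>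
            iterated_lim F \<Phi> [e] (?u(c := a i c, d := a n d))) \<U>"
          by (rule lim[rotated 3]) (use cde in auto)
        then show ?thesis by simp
      qed
      \<comment> \<open>With three coordinates, overwriting two coordinates of \<open>a k\<close>
        leaves only coordinate \<open>e\<close>. Outside \<open>{1..3}\<close> both tuples are
        \<open>undefined\<close>.\<close>
      have eq: "?u(c := a i c, d := a n d, e := a k e) = (a k)(c := a i c, d := a n d)" for i n k
      proof
        fix j
        show "(?u(c := a i c, d := a n d, e := a k e)) j = ((a k)(c := a i c, d := a n d)) j"
        proof (cases "j \<in> {c, d, e}")
          case True
          then show ?thesis using cde(2-4) by fastforce
        next
          case False
          then have "a k j = undefined"
            using PiE_arb[OF a[of k, unfolded ball_tuples_def]] unfolding cde(1) by blast
          then show ?thesis using False by simp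
        qed
      qed
      show "norm (\<Phi> (?u(c := a i c, d := a n d, e := a k e))) \<le> sup_norm 3 X \<Phi>" for i n k
        unfolding eq by (intro sup_norm_upper[OF X \<Phi>] ball_tuples_upd a mem ball_tuplesD[OF a])
      show "(\<Sum>i<m. sup_norm 3 X \<Phi> - norm (\<Phi> (?u(c := a i c, d := a n d, e := a k e)))) \<le> C"
        if "m \<le> n" "n < k" for m n k
        unfolding eq by (rule sum[OF _ that]) (use mem cde in \<open>simp add: index_pairs_def\<close>)
    qed
    then show ?thesis
      using arens_extension_eq_iterated_lim[OF normed_component[OF X] bm \<sigma> \<phi>c \<phi>(2)]
      unfolding js by simp
  qed
  moreover have "\<phi> \<in> (\<Pi>\<^sub>E i\<in>{1..3}. unit_ball (dual (dual (X i))))"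
    using \<phi>'(1) by (simp add: \<phi>_def)
  ultimately show ?thesis unfolding arens_attain_at_same_tuple_def by blast
qed

section \<open>Density of the attaining forms\<close>

theorem corollary1p4:
  fixes U :: "(nat \<Rightarrow> ('k::{real_normed_field, euclidean_space}, 'k + 'u) nspace) \<Rightarrow>
              ((nat \<Rightarrow> 'k + 'u) \<Rightarrow> 'k) set"
    and nU :: "(nat \<Rightarrow> ('k, 'k + 'u) nspace) \<Rightarrow> ((nat \<Rightarrow> 'k + 'u) \<Rightarrow> 'k) \<Rightarrow> real"
    and X :: "nat \<Rightarrow> ('k, 'k + 'u) nspace"
  assumes "banach_ideal 3 U nU"
    and "X \<in> banach_tuples 3"
  shows "norm_topology (fun_space (U X) (nU X)) closure_of
           {\<Phi> \<in> U X. arens_attain_at_same_tuple 3 X \<Phi>} = U X"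
proof -
  interpret banach_ideal 3 U nU by fact
  note X = \<open>X \<in> banach_tuples 3\<close>
  let ?V = "fun_space (U X) (nU X)"
  let ?S = "{\<Phi> \<in> U X. arens_attain_at_same_tuple 3 X \<Phi>}"
  interpret V: normed_space ?V by (rule normed[OF X])
  have "\<exists>\<Psi>\<in>?S. \<Psi> \<in> V.metric.mball \<Phi> r" if \<Phi>: "\<Phi> \<in> U X" and r: "r > 0" for \<Phi> r
  proof -
    \<comment> \<open>The approximation is only within a weak inequality, so \<open>r / 2\<close> is
      used to land in the open ball of radius \<open>r\<close>.\<close>
    obtain \<Psi> and a :: "nat \<Rightarrow> nat \<Rightarrow> 'k + 'u" and C where \<Psi>: "\<Psi> \<in> U X" "nU X (\<lambda>x. \<Psi> x - \<Phi> x) \<le> r / 2" "\<And>n. a n \<in> ball_tuples 3 X"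
      "\<And>c d m n k. (c, d) \<in> index_pairs 3 \<Longrightarrow> m \<le> n \<Longrightarrow> n < k \<Longrightarrow>
        (\<Sum>i<m. sup_norm 3 X \<Psi> - norm (\<Psi> ((a k)(c := a i c, d := a n d)))) \<le> C"
      using ex_close_form_with_summable_defects[OF X \<Phi> half_gt_zero[OF r]] by blast
    have "arens_attain_at_same_tuple 3 X \<Psi>"
      by (rule arens_attain_if_summable_defects[OF normed_ideal_axioms X \<Psi>(1,3,4)])
    moreover have "ndist ?V \<Phi> \<Psi> < r"
      using \<Psi>(1,2) \<Phi> r nU_diff_commute[OF X \<Phi> \<Psi>(1)] by (simp add: V.ndist_smult)
    then have "\<Psi> \<in> V.metric.mball \<Phi> r"
      unfolding V.metric.in_mball using \<Psi>(1) \<Phi> by simp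
    ultimately show ?thesis using \<Psi>(1) by blast
  qed
  then show ?thesis
    unfolding norm_topology_def V.metric.metric_closure_of by auto
qed

end
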